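(* Let $w\in\mathcal S_m$ and let $l_1,\dots,l_m$ be integers with $0\le l_i\le m-i$. Let $$\lambda=\Bigl(\tbinom m2,\ \dots,\ (i-1)m-\tbinom i2,\ \dots,\ 2m-3,\ m-1,\ 0\Bigr)$$ (the entries listed for $i=m,m-1,\dots,1$), and let $\lambda'=\lambda+(l_m,\dots,l_2,l_1)$. Then the coefficient of $x_1^{l_1}x_2^{l_2}\cdots x_m^{l_m}$ in the Schubert polynomial $\mathfrak S_w(x)$ is the Schubert structure constant $$c^{\,w(\lambda',m)}_{w,\ w(\lambda,m)}.$$
   Context: Permutations are written in one-line notation, $s_i$ is the transposition of $i,i+1$, $\omega_n=[n,\dots,2,1]$, $\mathcal S_\infty=\bigcup_n\mathcal S_n$. Schubert polynomials: with $s_i$ acting on $\mathbb Z[x_1,\dots,x_n]$ by exchanging $x_i,x_{i+1}$, let $\partial_i f=(f-s_if)/(x_i-x_{i+1})$ and $\partial_v=\partial_{i_1}\cdots\partial_{i_r}$ for any reduced word $v=s_{i_1}\cdots s_{i_r}$; put $\mathfrak S_{\omega_n}=x_1^{n-1}x_2^{n-2}\cdots x_{n-1}$ and $\mathfrak S_w=\partial_{w^{-1}\omega_n}\mathfrak S_{\omega_n}$ for $w\in\mathcal S_n$. $\mathfrak S_w$ does not depend on $n$, and $\{\mathfrak S_w\mid w\in\mathcal S_\infty\}$ is a $\mathbb Z$-basis of $\mathbb Z[x_1,x_2,\dots]$. Here the Schubert structure constants are those for multiplication of Schubert polynomials: $\mathfrak S_u\mathfrak S_v=\sum_{w\in\mathcal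 S_\infty}c^w_{u,v}\mathfrak S_w$. For a weakly decreasing sequence $\lambda=(\lambda_1\ge\dots\ge\lambda_m\ge0)$, $w(\lambda,m)\in\mathcal S_\infty$ is the Grassmannian permutation of shape $\lambda$ with descent at $m$: the permutation with $w_i<w_{i+1}$ for all $i\ne m$ and $(w_m-m,\,w_{m-1}-(m-1),\dots,w_1-1)=\lambda$. *)

theory Defs
  imports Main "HOL-Library.Poly_Mapping" "HOL-Combinatorics.Permutations"
begin

(* Polynomials in x_1, x_2, ... over the integers, as finitely supported functions from
   exponent vectors to coefficients.  The variable of index 0 is in the type but is never used. *)
type_synonym ipoly = "(nat \<Rightarrow>\<^sub>0 nat) \<Rightarrow>\<^sub>0 int"

definition Var :: "nat \<Rightarrow> ipoly" where
  "Var i = Poly_Mapping.single (Poly_Mapping.single i 1) 1"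

(* Permutations of the positive integers are functions on nat that fix 0. *)
definition S_infty :: "(nat \<Rightarrow> nat) set" where
  "S_infty = (\<Union>n. {w. w permutes {1..n}})"

definition longest_perm :: "nat \<Rightarrow> nat \<Rightarrow> nat" where
  "longest_perm n i = (if i \<in> {1..n} then n + 1 - i else i)"

definition word_perm :: "nat list \<Rightarrow> nat \<Rightarrow> nat" where
  "word_perm is = foldr (\<lambda>i u. transpose i (Suc i) \<circ> u) is id"

definition reduced_word :: "nat list \<Rightarrow> (nat \<Rightarrow> nat) \<Rightarrow> bool" where
  "reduced_word is v \<longleftrightarrow>
     set is \<subseteq> {1..} \<and> word_perm is = v \<and>
     (\<forall>js. set js \<subseteq> {1..} \<and> word_perm js = v \<longrightarrow> length is \<le> length js)"

(* s_i is an involution, so precomposing exponent vectors, and then coefficient functions,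
   with it exchanges the variables x_i and x_(i+1). *)
definition swap_vars :: "nat \<Rightarrow> ipoly \<Rightarrow> ipoly" where
  "swap_vars i = Poly_Mapping.map_key (Poly_Mapping.map_key (transpose i (Suc i)))"

(* The quotient (f - s_i f) / (x_i - x_(i+1)), which exists and is unique in the polynomial ring. *)
definition divdiff :: "nat \<Rightarrow> ipoly \<Rightarrow> ipoly" where
  "divdiff i f = (THE g. g * (Var i - Var (Suc i)) = f - swap_vars i f)"

(* The choice of reduced word does not matter. *)
definition divdiff_perm :: "(nat \<Rightarrow> nat) \<Rightarrow> ipoly \<Rightarrow> ipoly" where
  "divdiff_perm v = foldr divdiff (SOME is. reduced_word is v)"

definition schubert_in :: "nat \<Rightarrow> (nat \<Rightarrow> nat) \<Rightarrow> ipoly" where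
  "schubert_in n w = divdiff_perm (inv w \<circ> longest_perm n) (\<Prod>i\<in>{1..<n}. Var i ^ (n - i))"

(* The value is the same for every n such that w lies in S_n; the least one is taken. *)
definition schubert :: "(nat \<Rightarrow> nat) \<Rightarrow> ipoly" where
  "schubert w = schubert_in (LEAST n. w permutes {1..n}) w"

(* The coordinates of the product of two Schubert polynomials in the Schubert basis. *)
definition schubert_const :: "(nat \<Rightarrow> nat) \<Rightarrow> (nat \<Rightarrow> nat) \<Rightarrow> (nat \<Rightarrow> nat) \<Rightarrow> int" where
  "schubert_const u v w =
     Poly_Mapping.lookup
       (THE c :: (nat \<Rightarrow> nat) \<Rightarrow>\<^sub>0 int.
          Poly_Mapping.keys c \<subseteq> S_infty \<and>
          schubert u * schubert v =
            (\<Sum>z\<in>Poly_Mapping.keys c. of_int (Poly_Mapping.lookup c z) * schubert z)) w"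

definition grassmannian :: "int list \<Rightarrow> nat \<Rightarrow> nat \<Rightarrow> nat" where
  "grassmannian lam m =
     (THE w. w \<in> S_infty \<and> (\<forall>i\<ge>1. i \<noteq> m \<longrightarrow> w i < w (Suc i)) \<and>
        map (\<lambda>i. int (w i) - int i) (rev [1..<Suc m]) = lam)"

definition lambda_shape :: "nat \<Rightarrow> int list" where
  "lambda_shape m = map (\<lambda>i. (int i - 1) * int m - int (i choose 2)) (rev [1..<Suc m])"

definition lambda_shape' :: "nat \<Rightarrow> (nat \<Rightarrow> nat) \<Rightarrow> int list" where
  "lambda_shape' m l = map2 (+) (lambda_shape m) (map (\<lambda>i. int (l i)) (rev [1..<Suc m]))"

end

theory Submission
  imports Defs
begin

text \<open>
  Write \<open>v\<^sub>1 < \<dots> < v\<^sub>m\<close> for the first \<open>m\<close> values of a Grassmannian permutation \<open>v\<close> with descent at \<open>m\<close>,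
  and \<open>\<Delta>\<close> for the Vandermonde product of the \<open>x\<^sub>j - x\<^sub>i\<close> with \<open>i < j \<le> m\<close>.  The coordinate of a polynomial
  \<open>f\<close> at a Schubert polynomial is the constant term of a divided difference of \<open>f\<close>
  (\<open>divdiffs_schubert_dual\<close>, \<open>schubert_expansion\<close>, \<open>schubert_const_eq\<close>).  The heart of the proof is
  \<open>const_term_divdiffs_block_word\<close>: for the Grassmannian \<open>v\<close> and a polynomial \<open>f\<close> in \<open>x\<^sub>1, \<dots>, x\<^sub>m\<close> only, this
  constant term is the coefficient in \<open>\<Delta> f\<close> of the monomial whose exponent at \<open>x\<^sub>i\<close> is \<open>v\<^sub>i - 1\<close>.

  Let \<open>v\<close> and \<open>v'\<close> belong to \<open>\<lambda>\<close> and \<open>\<lambda>'\<close>, so that \<open>v'\<^sub>i = v\<^sub>i + l\<^sub>i\<close>, and put \<open>A = \<Delta> \<SS>\<^sub>v\<close>.  The formula turns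
  the structure constant into the coefficient of \<open>\<SS>\<^sub>w A\<close> with exponents \<open>v'\<^sub>i - 1\<close>.  The polynomial \<open>A\<close> is
  antisymmetric in \<open>x\<^sub>1, \<dots>, x\<^sub>m\<close>, and the formula for \<open>f = \<SS>\<^sub>v\<close> together with duality shows that among
  strictly increasing exponent vectors only \<open>(v\<^sub>i - 1)\<close> occurs in \<open>A\<close>, with coefficient 1: it is the alternant of
  Jacobi's bialternant formula.  The shape \<open>\<lambda>\<close> is chosen so that \<open>v\<^sub>i\<^sub>+\<^sub>1 - v\<^sub>i = m - i + 1\<close>, which exceeds \<open>l\<^sub>i\<close>.
  An exponent vector of \<open>A\<close> that is
  bounded by \<open>(v'\<^sub>i - 1)\<close> then has no choice but to be \<open>(v\<^sub>i - 1)\<close> (\<open>coeff_alternant_eq_0\<close>), and what remains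
  for \<open>\<SS>\<^sub>w\<close> is the exponent vector \<open>(l\<^sub>i)\<close>.

  Duality rests on the independence of \<open>\<partial>\<^sub>v\<close> from the reduced word (\<open>divdiffs_reduced_unique\<close>), on
  \<open>\<partial>\<^sub>i \<SS>\<^sub>u = \<SS>\<^sub>u\<^sub>s\<^sub>i\<close> at a descent \<open>i\<close> of \<open>u\<close> and \<open>0\<close> elsewhere (\<open>divdiff_schubert\<close>), and on the fact that a
  polynomial vanishes if all its iterated divided differences have constant term zero
  (\<open>divdiffs_const_terms_zero\<close>).
\<close>

section \<open>Polynomials and divided differences\<close>

abbreviation coeff :: "ipoly \<Rightarrow> (nat \<Rightarrow>\<^sub>0 nat) \<Rightarrow> int" where
  "coeff \<equiv> Poly_Mapping.lookup"

abbreviation expo :: "(nat \<Rightarrow>\<^sub>0 nat) \<Rightarrow> nat \<Rightarrow> nat" where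
  "expo \<equiv> Poly_Mapping.lookup"

definition swap_exp :: "nat \<Rightarrow> (nat \<Rightarrow>\<^sub>0 nat) \<Rightarrow> (nat \<Rightarrow>\<^sub>0 nat)" where
  "swap_exp i = Poly_Mapping.map_key (transpose i (Suc i))"

lemma inj_transpose: "inj (transpose i j)"
  by (rule injI) (metis transpose_involutory)

lemma expo_swap_exp: "expo (swap_exp i k) j = expo k (transpose i (Suc i) j)"
  by (simp add: swap_exp_def map_key.rep_eq inj_transpose)

lemma swap_exp_involutory [simp]: "swap_exp i (swap_exp i k) = k"
  by (rule poly_mapping_eqI) (simp add: expo_swap_exp)

lemma inj_swap_exp: "inj (swap_exp i)"
  by (metis injI swap_exp_involutory)

lemma swap_exp_add: "swap_exp i (k + l) = swap_exp i k + swap_exp i l"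
  by (rule poly_mapping_eqI) (simp add: expo_swap_exp lookup_add)

lemma swap_exp_single: "swap_exp i (Poly_Mapping.single j n) = Poly_Mapping.single (transpose i (Suc i) j) n"
  by (rule poly_mapping_eqI) (auto simp: expo_swap_exp lookup_single when_def transpose_def)

lemma coeff_swap_vars: "coeff (swap_vars i f) k = coeff f (swap_exp i k)"
  unfolding swap_vars_def swap_exp_def[symmetric] by (simp add: map_key.rep_eq inj_swap_exp)

lemma swap_vars_involutory [simp]: "swap_vars i (swap_vars i f) = f"
  by (rule poly_mapping_eqI) (simp add: coeff_swap_vars)

lemma swap_vars_diff: "swap_vars i (f - g) = swap_vars i f - swap_vars i g"
  by (rule poly_mapping_eqI) (simp add: coeff_swap_vars lookup_minus)

lemma swap_vars_0 [simp]: "swap_vars i 0 = 0"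
  by (rule poly_mapping_eqI) (simp add: coeff_swap_vars)

text \<open>
  The monomial with exponent vector \<open>k\<close> is \<open>frag_of k\<close>.  Statements that are linear in a polynomial are proved
  by \<open>frag_induction\<close>, which reduces them to monomials.
\<close>
lemma swap_vars_frag_of: "swap_vars i (frag_of k) = frag_of (swap_exp i k)"
  by (rule poly_mapping_eqI) (auto simp: coeff_swap_vars)

lemma swap_vars_1 [simp]: "swap_vars i 1 = 1"
proof -
  have "swap_exp i 0 = 0"
    by (rule poly_mapping_eqI) (simp add: expo_swap_exp)
  then show ?thesis
    using swap_vars_frag_of[of i 0] by simp
qed

lemma swap_vars_add: "swap_vars i (f + g) = swap_vars i f + swap_vars i g"
  by (rule poly_mapping_eqI) (simp add: coeff_swap_vars lookup_add)

lemma swap_vars_mult: "swap_vars i (f * g) = swap_vars i f * swap_vars i g"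
proof -
  have *: "swap_vars i (frag_of k * g) = frag_of (swap_exp i k) * swap_vars i g" for k
    using subset_UNIV[of "Poly_Mapping.keys g"]
    by (induction g rule: frag_induction)
       (auto simp: mult_single swap_vars_frag_of swap_exp_add swap_vars_diff algebra_simps)
  show ?thesis
    using subset_UNIV[of "Poly_Mapping.keys f"]
    by (induction f rule: frag_induction)
       (auto simp: * swap_vars_frag_of swap_vars_diff left_diff_distrib)
qed

lemma swap_vars_Var: "swap_vars i (Var j) = Var (transpose i (Suc i) j)"
  by (simp add: Var_def swap_vars_frag_of swap_exp_single)

lemma Var_neq: "i \<noteq> j \<Longrightarrow> Var i - Var j \<noteq> 0"
proof
  assume "i \<noteq> j" "Var i - Var j = 0"
  then have "Poly_Mapping.single i (1::nat) = Poly_Mapping.single j 1"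
    by (simp add: Var_def frag_of_eq)
  then have "{i} = {j}"
    by (metis keys_single zero_neq_one)
  with \<open>i \<noteq> j\<close> show False by simp
qed

lemma Var_power: "Var i ^ n = frag_of (Poly_Mapping.single i n)"
  by (induction n) (simp_all add: Var_def mult_single single_add[symmetric])

definition total_degree :: "(nat \<Rightarrow>\<^sub>0 nat) \<Rightarrow> nat" where
  "total_degree k = (\<Sum>j\<in>Poly_Mapping.keys k. expo k j)"

lemma total_degree_superset: "finite A \<Longrightarrow> Poly_Mapping.keys k \<subseteq> A \<Longrightarrow> total_degree k = (\<Sum>j\<in>A. expo k j)"
  unfolding total_degree_def by (rule sum.mono_neutral_left) (auto simp: in_keys_iff)

lemma total_degree_add: "total_degree (k + l) = total_degree k + total_degree l"
proof -
  have "total_degree (k + l) = (\<Sum>j\<in>Poly_Mapping.keys k \<union> Poly_Mapping.keys l. expo (k + l) j)"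
    using keys_add[of k l] by (intro total_degree_superset) auto
  then show ?thesis
    using total_degree_superset[of "Poly_Mapping.keys k \<union> Poly_Mapping.keys l" k]
      total_degree_superset[of "Poly_Mapping.keys k \<union> Poly_Mapping.keys l" l]
    by (simp add: lookup_add sum.distrib)
qed

lemma total_degree_single [simp]: "total_degree (Poly_Mapping.single j n) = n"
  by (simp add: total_degree_def)

lemma total_degree_eq_0_iff: "total_degree k = 0 \<longleftrightarrow> k = 0"
  by (auto simp: total_degree_def in_keys_iff intro: poly_mapping_eqI)

text \<open>
  The relation between the exponent vectors of \<open>\<partial>\<^sub>i f\<close> and those of \<open>f\<close>; degree bounds, homogeneity and the
  control of the occurring variables all follow from it.
\<close>
definition lowered :: "nat \<Rightarrow> (nat \<Rightarrow>\<^sub>0 nat) \<Rightarrow> (nat \<Rightarrow>\<^sub>0 nat) \<Rightarrow> bool" where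
  "lowered i k' k \<longleftrightarrow> total_degree k = Suc (total_degree k') \<and> (\<forall>j. j \<noteq> i \<and> j \<noteq> Suc i \<longrightarrow> expo k' j = expo k j)"

lemma total_degree_swap_exp: "total_degree (swap_exp i k) = total_degree k"
proof -
  have *: "Poly_Mapping.keys (swap_exp i k) = transpose i (Suc i) ` Poly_Mapping.keys k"
  proof (intro set_eqI iffI)
    fix j assume "j \<in> Poly_Mapping.keys (swap_exp i k)"
    then show "j \<in> transpose i (Suc i) ` Poly_Mapping.keys k"
      by (intro image_eqI[where x = "transpose i (Suc i) j"]) (auto simp: in_keys_iff expo_swap_exp)
  qed (auto simp: in_keys_iff expo_swap_exp)
  show ?thesis
    unfolding total_degree_def * by (subst sum.reindex) (auto simp: expo_swap_exp intro: inj_on_subset[OF inj_transpose])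
qed

lemma lowered_swap_exp: "lowered i k' (swap_exp i k) \<Longrightarrow> lowered i k' k"
  by (auto simp: lowered_def total_degree_swap_exp expo_swap_exp)

text \<open>
  The common part of the two monomials is symmetric in \<open>x\<^sub>i\<close> and \<open>x\<^sub>i\<^sub>+\<^sub>1\<close>, so this is the factorization of
  \<open>x\<^sub>i\<^sup>n - x\<^sub>i\<^sub>+\<^sub>1\<^sup>n\<close>.
\<close>
lemma frag_of_quotient_ordered:
  assumes "expo k (Suc i) \<le> expo k i"
  shows "\<exists>g. g * (Var i - Var (Suc i)) = frag_of k - frag_of (swap_exp i k) \<and>
    (\<forall>k'\<in>Poly_Mapping.keys g. lowered i k' k)"
proof -
  define n where "n = expo k i - expo k (Suc i)"
  define r where "r = k - Poly_Mapping.single i n"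
  have k: "k = r + Poly_Mapping.single i n"
    by (rule poly_mapping_eqI) (auto simp: r_def n_def lookup_add lookup_minus lookup_single when_def)
  have rsw: "swap_exp i r = r"
    using assms
    by (intro poly_mapping_eqI)
       (auto simp: r_def n_def expo_swap_exp lookup_minus lookup_single when_def transpose_def)
  have swk: "swap_exp i k = r + Poly_Mapping.single (Suc i) n"
    by (subst k) (simp add: swap_exp_add rsw swap_exp_single)
  define h where "h p = r + Poly_Mapping.single (Suc i) (n - Suc p) + Poly_Mapping.single i p" for p
  define g where "g = (\<Sum>p<n. frag_of (h p))"
  have "(\<Sum>p<n. Var (Suc i) ^ (n - Suc p) * Var i ^ p) * (Var i - Var (Suc i)) = Var i ^ n - Var (Suc i) ^ n"
    by (simp add: power_diff_sumr2 mult.commute)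
  then have "frag_of r * ((\<Sum>p<n. Var (Suc i) ^ (n - Suc p) * Var i ^ p) * (Var i - Var (Suc i)))
    = frag_of k - frag_of (swap_exp i k)"
    by (simp only: Var_power right_diff_distrib mult_single swk mult_1 flip: k)
  moreover have "frag_of r * (\<Sum>p<n. Var (Suc i) ^ (n - Suc p) * Var i ^ p) = g"
    by (simp add: g_def h_def Var_power mult_single sum_distrib_left add.assoc)
  moreover have "lowered i k' k" if "k' \<in> Poly_Mapping.keys g" for k'
  proof -
    have "k' \<in> (\<Union>p\<in>{..<n}. Poly_Mapping.keys (frag_of (h p)))"
      using that keys_sum[of "\<lambda>p. frag_of (h p)" "{..<n}"] unfolding g_def by blast
    then obtain p where p: "p < n" "k' = h p"
      by auto
    have "total_degree k = Suc (total_degree k')"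
      using p by (simp add: k h_def total_degree_add)
    then show ?thesis
      by (auto simp: lowered_def p h_def k lookup_add lookup_single when_def)
  qed
  ultimately show ?thesis
    by (intro exI[of _ g]) (auto simp: mult.assoc)
qed

lemma frag_of_quotient:
  "\<exists>g. g * (Var i - Var (Suc i)) = frag_of k - frag_of (swap_exp i k) \<and>
    (\<forall>k'\<in>Poly_Mapping.keys g. lowered i k' k)"
proof (cases "expo k (Suc i) \<le> expo k i")
  case True
  then show ?thesis by (rule frag_of_quotient_ordered)
next
  case False
  then have "expo (swap_exp i k) (Suc i) \<le> expo (swap_exp i k) i"
    by (simp add: expo_swap_exp)
  from frag_of_quotient_ordered[OF this] obtain g where
    g: "g * (Var i - Var (Suc i)) = frag_of (swap_exp i k) - frag_of k"
    "\<forall>k'\<in>Poly_Mapping.keys g. lowered i k' (swap_exp i k)"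
    by auto
  then show ?thesis
    by (intro exI[of _ "- g"]) (auto simp: lowered_swap_exp)
qed

lemma divdiff_exists:
  "\<exists>g. g * (Var i - Var (Suc i)) = f - swap_vars i f \<and>
    (\<forall>k'\<in>Poly_Mapping.keys g. \<exists>k\<in>Poly_Mapping.keys f. lowered i k' k)"
proof -
  obtain G where G: "\<And>k. G k * (Var i - Var (Suc i)) = frag_of k - frag_of (swap_exp i k)"
    "\<And>k k'. k' \<in> Poly_Mapping.keys (G k) \<Longrightarrow> lowered i k' k"
    using frag_of_quotient[where i = i] by metis
  have "frag_extend G f * (Var i - Var (Suc i)) = f - swap_vars i f"
    using subset_UNIV[of "Poly_Mapping.keys f"]
    by (induction f rule: frag_induction)
       (auto simp: G frag_extend_diff swap_vars_diff swap_vars_frag_of left_diff_distrib)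
  then show ?thesis
    using keys_frag_extend[of G f] G(2) by blast
qed

lemma Var_diff_cancel: "f * (Var i - Var (Suc i)) = g * (Var i - Var (Suc i)) \<Longrightarrow> f = g"
  using Var_neq[of i "Suc i"] by auto

text \<open>
  The polynomial ring is an integral domain, so every identity between divided differences can be checked after
  multiplication with differences of variables.
\<close>
lemma divdiff_unique:
  assumes "g * (Var i - Var (Suc i)) = f - swap_vars i f"
  shows "divdiff i f = g"
  unfolding divdiff_def by (rule the_equality) (use assms Var_diff_cancel in metis)+

lemma divdiff_mult: "divdiff i f * (Var i - Var (Suc i)) = f - swap_vars i f"
  using divdiff_exists[of i f] divdiff_unique by metis

lemma keys_divdiff: "k' \<in> Poly_Mapping.keys (divdiff i f) \<Longrightarrow> \<exists>k\<in>Poly_Mapping.keys f. lowered i k' k"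
  using divdiff_exists[of i f] divdiff_unique by metis

lemma divdiff_0 [simp]: "divdiff i 0 = 0"
  by (rule divdiff_unique) simp

lemma divdiff_diff: "divdiff i (f - g) = divdiff i f - divdiff i g"
  by (rule divdiff_unique) (simp add: divdiff_mult swap_vars_diff left_diff_distrib)

lemma divdiff_eq_0_iff: "divdiff i f = 0 \<longleftrightarrow> swap_vars i f = f"
  using divdiff_mult[of i f] Var_neq[of i "Suc i"] by auto

lemma divdiff_mult_invariant:
  assumes "swap_vars i g = g"
  shows "divdiff i (f * g) = divdiff i f * g"
proof (rule divdiff_unique)
  have "divdiff i f * g * (Var i - Var (Suc i)) = (f - swap_vars i f) * g"
    using divdiff_mult[of i f] by (metis mult.assoc mult.commute)
  then show "divdiff i f * g * (Var i - Var (Suc i)) = f * g - swap_vars i (f * g)"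
    by (simp add: swap_vars_mult assms left_diff_distrib)
qed

lemma swap_vars_divdiff: "swap_vars i (divdiff i f) = divdiff i f"
proof (rule Var_diff_cancel)
  show "swap_vars i (divdiff i f) * (Var i - Var (Suc i)) = divdiff i f * (Var i - Var (Suc i))"
  proof -
    have "swap_vars i (divdiff i f) * (Var (Suc i) - Var i) = swap_vars i f - f"
      using arg_cong[OF divdiff_mult[of i f], of "swap_vars i"]
      by (simp add: swap_vars_mult swap_vars_diff swap_vars_Var)
    then have "- (swap_vars i (divdiff i f) * (Var (Suc i) - Var i)) = f - swap_vars i f"
      by simp
    then show ?thesis
      by (simp only: divdiff_mult flip: mult_minus_right) simp
  qed
qed

lemma divdiff_twice [simp]: "divdiff i (divdiff i f) = 0"
  by (simp add: divdiff_eq_0_iff swap_vars_divdiff)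

lemma swap_vars_commute:
  assumes "Suc i < j"
  shows "swap_vars i (swap_vars j f) = swap_vars j (swap_vars i f)"
proof -
  have "swap_exp j (swap_exp i k) = swap_exp i (swap_exp j k)" for k
    using assms by (intro poly_mapping_eqI) (auto simp: expo_swap_exp transpose_def)
  then show ?thesis
    by (intro poly_mapping_eqI) (simp add: coeff_swap_vars)
qed

lemma swap_vars_braid:
  "swap_vars i (swap_vars (Suc i) (swap_vars i f)) = swap_vars (Suc i) (swap_vars i (swap_vars (Suc i) f))"
proof -
  have "swap_exp i (swap_exp (Suc i) (swap_exp i k)) = swap_exp (Suc i) (swap_exp i (swap_exp (Suc i) k))" for k
    by (intro poly_mapping_eqI) (auto simp: expo_swap_exp transpose_def)
  then show ?thesis
    by (intro poly_mapping_eqI) (simp add: coeff_swap_vars)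
qed

lemma divdiff_commute:
  assumes "Suc i < j"
  shows "divdiff i (divdiff j f) = divdiff j (divdiff i f)"
proof -
  let ?x = "Var i - Var (Suc i)" and ?y = "Var j - Var (Suc j)"
  have inv: "swap_vars i ?y = ?y" "swap_vars j ?x = ?x"
    using assms by (auto simp: swap_vars_diff swap_vars_Var transpose_def)
  have 1: "divdiff i (divdiff j f) * ?x * ?y = f - swap_vars j f - swap_vars i f + swap_vars i (swap_vars j f)"
  proof -
    have "divdiff i (divdiff j f) * ?x * ?y = divdiff j f * ?y - swap_vars i (divdiff j f * ?y)"
      by (simp only: divdiff_mult[of i] left_diff_distrib swap_vars_mult inv)
    then show ?thesis
      by (simp add: divdiff_mult swap_vars_diff)
  qed
  have 2: "divdiff j (divdiff i f) * ?x * ?y = f - swap_vars i f - swap_vars j f + swap_vars j (swap_vars i f)"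
  proof -
    have "divdiff j (divdiff i f) * ?y * ?x = divdiff i f * ?x - swap_vars j (divdiff i f * ?x)"
      by (simp only: divdiff_mult[of j] left_diff_distrib swap_vars_mult inv)
    then have "divdiff j (divdiff i f) * ?y * ?x = f - swap_vars i f - swap_vars j f + swap_vars j (swap_vars i f)"
      by (simp add: divdiff_mult swap_vars_diff)
    then show ?thesis
      by (metis mult.assoc mult.commute)
  qed
  have "divdiff i (divdiff j f) * ?x * ?y = divdiff j (divdiff i f) * ?x * ?y"
    using 1 2 swap_vars_commute[OF assms] by simp
  then show ?thesis
    using Var_neq[of i "Suc i"] Var_neq[of j "Suc j"] by auto
qed

text \<open>
  Multiplied with \<open>(x\<^sub>i - x\<^sub>i\<^sub>+\<^sub>1) (x\<^sub>i\<^sub>+\<^sub>1 - x\<^sub>i\<^sub>+\<^sub>2) (x\<^sub>i - x\<^sub>i\<^sub>+\<^sub>2)\<close>, both sides become the alternating sum of \<open>f\<close>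
  over the six permutations of the three variables.
\<close>
lemma divdiff_braid:
  "divdiff i (divdiff (Suc i) (divdiff i f)) = divdiff (Suc i) (divdiff i (divdiff (Suc i) f))"
proof -
  let ?j = "Suc i"
  let ?x = "Var i" and ?y = "Var (Suc i)" and ?z = "Var (Suc (Suc i))"
  let ?s = "swap_vars i" and ?t = "swap_vars (Suc i)"
  have s: "?s ?x = ?y" "?s ?y = ?x" "?s ?z = ?z" and t: "?t ?x = ?x" "?t ?y = ?z" "?t ?z = ?y"
    by (auto simp: swap_vars_Var transpose_def)
  have A: "divdiff i (divdiff ?j (divdiff i f)) * (?x - ?y) * (?y - ?z) * (?x - ?z) =
    f - ?s f - ?t f + ?t (?s f) + ?s (?t f) - ?s (?t (?s f))"
  proof -
    define a b c where "a = divdiff i f" and "b = divdiff ?j a" and "c = divdiff i b"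
    have a: "a * (?x - ?y) = f - ?s f" and b: "b * (?y - ?z) = a - ?t a" and c: "c * (?x - ?y) = b - ?s b"
      by (simp_all add: a_def b_def c_def divdiff_mult)
    have sa: "?s a = a"
      by (simp add: a_def swap_vars_divdiff)
    have sb: "?s b * (?x - ?z) = a - ?s (?t a)"
      using arg_cong[OF b, of ?s] by (simp add: swap_vars_mult swap_vars_diff s sa)
    have ta: "?t a * (?x - ?z) = ?t f - ?t (?s f)"
      using arg_cong[OF a, of ?t] by (simp add: swap_vars_mult swap_vars_diff t)
    have sta: "?s (?t a) * (?y - ?z) = ?s (?t f) - ?s (?t (?s f))"
      using arg_cong[OF ta, of ?s] by (simp add: swap_vars_mult swap_vars_diff s)
    have "c * (?x - ?y) * (?y - ?z) * (?x - ?z) = (b * (?y - ?z)) * (?x - ?z) - (?s b * (?x - ?z)) * (?y - ?z)"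
      by (simp only: c) (simp add: algebra_simps)
    also have "\<dots> = a * (?x - ?y) - ?t a * (?x - ?z) + ?s (?t a) * (?y - ?z)"
      by (simp only: b sb) (simp add: algebra_simps)
    finally show ?thesis
      unfolding a ta sta by (simp add: a_def b_def c_def algebra_simps)
  qed
  have B: "divdiff ?j (divdiff i (divdiff ?j f)) * (?x - ?y) * (?y - ?z) * (?x - ?z) =
    f - ?t f - ?s f + ?s (?t f) + ?t (?s f) - ?t (?s (?t f))"
  proof -
    define a b c where "a = divdiff ?j f" and "b = divdiff i a" and "c = divdiff ?j b"
    have a: "a * (?y - ?z) = f - ?t f" and b: "b * (?x - ?y) = a - ?s a" and c: "c * (?y - ?z) = b - ?t b"
      by (simp_all add: a_def b_def c_def divdiff_mult)
    have ta: "?t a = a"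
      by (simp add: a_def swap_vars_divdiff)
    have tb: "?t b * (?x - ?z) = a - ?t (?s a)"
      using arg_cong[OF b, of ?t] by (simp add: swap_vars_mult swap_vars_diff t ta)
    have sa: "?s a * (?x - ?z) = ?s f - ?s (?t f)"
      using arg_cong[OF a, of ?s] by (simp add: swap_vars_mult swap_vars_diff s)
    have tsa: "?t (?s a) * (?x - ?y) = ?t (?s f) - ?t (?s (?t f))"
      using arg_cong[OF sa, of ?t] by (simp add: swap_vars_mult swap_vars_diff t)
    have "c * (?x - ?y) * (?y - ?z) * (?x - ?z) = (c * (?y - ?z)) * (?x - ?y) * (?x - ?z)"
      by (simp add: algebra_simps)
    also have "\<dots> = (b * (?x - ?y)) * (?x - ?z) - (?t b * (?x - ?z)) * (?x - ?y)"
      by (simp only: c) (simp add: algebra_simps)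
    also have "\<dots> = a * (?y - ?z) - ?s a * (?x - ?z) + ?t (?s a) * (?x - ?y)"
      by (simp only: b tb) (simp add: algebra_simps)
    finally show ?thesis
      unfolding a sa tsa by (simp add: a_def b_def c_def algebra_simps)
  qed
  have "divdiff i (divdiff ?j (divdiff i f)) * (?x - ?y) * (?y - ?z) * (?x - ?z) =
    divdiff ?j (divdiff i (divdiff ?j f)) * (?x - ?y) * (?y - ?z) * (?x - ?z)"
    unfolding A B by (simp add: swap_vars_braid)
  then show ?thesis
    using Var_neq[of i "Suc i"] Var_neq[of "Suc i" "Suc (Suc i)"] Var_neq[of i "Suc (Suc i)"] by auto
qed

section \<open>Permutations, inversions and reduced words\<close>

abbreviation adj :: "nat \<Rightarrow> nat \<Rightarrow> nat" where
  "adj i \<equiv> transpose i (Suc i)"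

lemma S_infty_iff: "v \<in> S_infty \<longleftrightarrow> (\<exists>n. v permutes {1..n})"
  by (auto simp: S_infty_def)

lemma S_infty_common:
  assumes "u \<in> S_infty" "v \<in> S_infty"
  obtains n where "u permutes {1..n}" "v permutes {1..n}"
proof -
  obtain a b where "u permutes {1..a}" "v permutes {1..b}"
    using assms by (auto simp: S_infty_iff)
  then have "u permutes {1..max a b}" "v permutes {1..max a b}"
    using permutes_subset[of u "{1..a}" "{1..max a b}"] permutes_subset[of v "{1..b}" "{1..max a b}"] by auto
  then show ?thesis by (rule that)
qed

lemma S_infty_bij: "v \<in> S_infty \<Longrightarrow> bij v"
  by (auto simp: S_infty_iff permutes_bij)

lemma S_infty_0: "v \<in> S_infty \<Longrightarrow> v 0 = 0"
  by (auto simp: S_infty_iff permutes_def)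

lemma S_infty_id [simp]: "id \<in> S_infty"
  using permutes_id by (auto simp: S_infty_iff)

lemma adj_permutes: "1 \<le> i \<Longrightarrow> i < n \<Longrightarrow> adj i permutes {1..n}"
  by (rule permutes_swap_id) auto

lemma adj_S_infty: "1 \<le> i \<Longrightarrow> adj i \<in> S_infty"
  using adj_permutes[of i "Suc i"] by (auto simp: S_infty_iff)

lemma S_infty_comp: "u \<in> S_infty \<Longrightarrow> v \<in> S_infty \<Longrightarrow> u \<circ> v \<in> S_infty"
  by (metis S_infty_common S_infty_iff permutes_compose)

lemma S_infty_inv: "v \<in> S_infty \<Longrightarrow> inv v \<in> S_infty"
  unfolding S_infty_iff using permutes_inv by blast

lemma S_infty_adj: "v \<in> S_infty \<Longrightarrow> 1 \<le> i \<Longrightarrow> v \<circ> adj i \<in> S_infty"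
  by (simp add: S_infty_comp adj_S_infty)

lemma adj_adj [simp]: "v \<circ> adj i \<circ> adj i = v"
  by (simp add: comp_assoc)

definition inversions :: "(nat \<Rightarrow> nat) \<Rightarrow> (nat \<times> nat) set" where
  "inversions v = {(a, b). a < b \<and> v b < v a}"

definition perm_length :: "(nat \<Rightarrow> nat) \<Rightarrow> nat" where
  "perm_length v = card (inversions v)"

lemma finite_inversions:
  assumes "v \<in> S_infty"
  shows "finite (inversions v)"
proof -
  obtain n where n: "v permutes {1..n}"
    using assms by (auto simp: S_infty_iff)
  have "inversions v \<subseteq> {..n} \<times> {..n}"
  proof clarsimp
    fix a b assume "(a, b) \<in> inversions v"
    then have ab: "a < b" "v b < v a"
      by (auto simp: inversions_def)
    have "b \<le> n"
    proof (rule ccontr)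
      assume "\<not> b \<le> n"
      then have "v b = b"
        using n by (simp add: permutes_not_in)
      moreover have "v a \<le> max a n"
        using permutes_in_image[OF n, of a] permutes_not_in[OF n, of a] by (cases "a \<in> {1..n}") auto
      ultimately show False
        using ab \<open>\<not> b \<le> n\<close> by auto
    qed
    then show "a \<le> n \<and> b \<le> n"
      using ab by simp
  qed
  then show ?thesis
    by (rule finite_subset) auto
qed

text \<open>
  Exchanging two adjacent positions keeps the order of every other pair of positions, so the inversions are
  transported along the exchange and \<open>(i, i + 1)\<close> is the only new one.
\<close>
lemma perm_length_adj_ascent:
  assumes v: "v \<in> S_infty" and asc: "v i < v (Suc i)"
  shows "perm_length (v \<circ> adj i) = Suc (perm_length v)"
proof -
  let ?s = "map_prod (adj i) (adj i)"
  have less: "adj i a < adj i b" if "a < b" "(a, b) \<noteq> (i, Suc i)" for a b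
    using that by (auto simp: transpose_def)
  let ?L = "inversions (v \<circ> adj i)" and ?R = "insert (i, Suc i) (?s ` inversions v)"
  have "(a, b) \<in> ?L \<longleftrightarrow> (a, b) \<in> ?R" for a b
  proof
    assume ab: "(a, b) \<in> ?L"
    show "(a, b) \<in> ?R"
    proof (cases "(a, b) = (i, Suc i)")
      case False
      then have "(adj i a, adj i b) \<in> inversions v"
        using ab less[of a b] by (auto simp: inversions_def)
      then show ?thesis
        by (intro insertI2 image_eqI[where x = "(adj i a, adj i b)"]) auto
    qed auto
  next
    assume "(a, b) \<in> ?R"
    then consider "(a, b) = (i, Suc i)"
      | c d where "(c, d) \<in> inversions v" "a = adj i c" "b = adj i d"
      by auto
    then show "(a, b) \<in> ?L"
    proof cases
      case 1
      then show ?thesis using asc by (auto simp: inversions_def)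
    next
      case 2
      then have "(c, d) \<noteq> (i, Suc i)"
        using asc by (auto simp: inversions_def)
      then show ?thesis using less[of c d] 2 by (auto simp: inversions_def)
    qed
  qed
  then have "?L = ?R" by (intro set_eqI) (metis surj_pair)
  moreover have "(i, Suc i) \<notin> ?s ` inversions v"
    by (auto simp: inversions_def transpose_def split: if_splits)
  moreover have "inj_on ?s (inversions v)"
    by (intro inj_on_subset[OF prod.inj_map[OF inj_transpose inj_transpose]] subset_UNIV)
  ultimately show ?thesis
    using finite_inversions[OF v] by (simp add: perm_length_def card_image)
qed

lemma S_infty_neq_Suc: "v \<in> S_infty \<Longrightarrow> v i \<noteq> v (Suc i)"
  using S_infty_bij[of v] by (metis bij_is_inj injD n_not_Suc_n)

lemma perm_length_adj_descent:
  assumes v: "v \<in> S_infty" and i: "1 \<le> i" and desc: "v (Suc i) < v i"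
  shows "perm_length v = Suc (perm_length (v \<circ> adj i))"
  using perm_length_adj_ascent[of "v \<circ> adj i" i] assms S_infty_adj[OF v i] by simp

lemma increasing_S_infty_eq_id:
  assumes v: "v \<in> S_infty" and inc: "\<And>i. 1 \<le> i \<Longrightarrow> v i < v (Suc i)"
  shows "v = id"
proof
  fix i
  have mono: "strict_mono v"
  proof (rule strict_mono_Suc_iff[THEN iffD2], rule allI)
    fix i show "v i < v (Suc i)"
      using inc[of i] S_infty_0[OF v] S_infty_neq_Suc[OF v, of 0] by (cases i) auto
  qed
  show "v i = id i"
  proof (induction i rule: less_induct)
    case (less i)
    obtain p where p: "v p = i"
      using S_infty_bij[OF v] by (metis bij_pointE)
    have "\<not> p < i"
      using less[of p] p by auto
    moreover have "i \<le> v i"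
      using strict_mono_imp_increasing[OF mono] .
    ultimately show ?case
      using p mono by (metis id_apply le_antisym not_less strict_mono_less_eq)
  qed
qed

lemma word_perm_append: "word_perm (as @ bs) = word_perm as \<circ> word_perm bs"
  by (induction as) (auto simp: word_perm_def)

lemma word_perm_Nil [simp]: "word_perm [] = id"
  by (simp add: word_perm_def)

lemma word_perm_Cons [simp]: "word_perm (i # as) = adj i \<circ> word_perm as"
  by (simp add: word_perm_def)

lemma word_perm_snoc: "word_perm (as @ [i]) = word_perm as \<circ> adj i"
  unfolding word_perm_append by (auto simp: fun_eq_iff)

lemma word_perm_S_infty: "set as \<subseteq> {1..} \<Longrightarrow> word_perm as \<in> S_infty"
  by (induction as) (simp_all add: S_infty_comp adj_S_infty)

lemma perm_length_id [simp]: "perm_length id = 0"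
proof -
  have "inversions id = {}" by (auto simp: inversions_def)
  then show ?thesis by (simp add: perm_length_def)
qed

lemma perm_length_adj_le: "v \<in> S_infty \<Longrightarrow> 1 \<le> i \<Longrightarrow> perm_length (v \<circ> adj i) \<le> Suc (perm_length v)"
  using perm_length_adj_ascent[of v i] perm_length_adj_descent[of v i] S_infty_neq_Suc[of v i]
  by (metis Suc_leI le_SucI less_Suc_eq_le linorder_neqE_nat order_refl)

lemma perm_length_word_le: "set as \<subseteq> {1..} \<Longrightarrow> perm_length (word_perm as) \<le> length as"
proof (induction as rule: rev_induct)
  case (snoc i as)
  then have "perm_length (word_perm as \<circ> adj i) \<le> Suc (perm_length (word_perm as))"
    "perm_length (word_perm as) \<le> length as"
    by (simp_all add: perm_length_adj_le word_perm_S_infty)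
  then show ?case
    unfolding word_perm_snoc length_append_singleton by linarith
qed simp

text \<open>
  Reducedness measured by inversions; \<open>reduced_word_iff\<close> identifies it with minimality of the length.
\<close>
definition reduced :: "nat list \<Rightarrow> bool" where
  "reduced as \<longleftrightarrow> set as \<subseteq> {1..} \<and> length as = perm_length (word_perm as)"

lemma reduced_letters: "reduced as \<Longrightarrow> set as \<subseteq> {1..}"
  by (simp add: reduced_def)

lemma reduced_exists: "v \<in> S_infty \<Longrightarrow> \<exists>as. reduced as \<and> word_perm as = v"
proof (induction "perm_length v" arbitrary: v)
  case 0
  have "v i < v (Suc i)" if "1 \<le> i" for i
    using that 0 perm_length_adj_descent[of v i] S_infty_neq_Suc[of v i]
    by (metis Zero_neq_Suc linorder_neqE_nat)
  then have "v = id"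
    using increasing_S_infty_eq_id 0 by blast
  then show ?case
    by (intro exI[of _ "[]"]) (simp add: reduced_def)
next
  case (Suc n)
  have "v \<noteq> id"
    using Suc.hyps by auto
  then obtain i where i: "1 \<le> i" "v (Suc i) < v i"
    using increasing_S_infty_eq_id[of v] Suc.prems S_infty_neq_Suc[of v] by (metis linorder_neqE_nat)
  have *: "perm_length v = Suc (perm_length (v \<circ> adj i))"
    by (rule perm_length_adj_descent) (use i Suc in auto)
  then obtain as where as: "reduced as" "word_perm as = v \<circ> adj i"
    using Suc i S_infty_adj by (metis Suc_inject)
  then have "word_perm (as @ [i]) = v"
    by (simp add: word_perm_snoc)
  then show ?case
    using * as i by (intro exI[of _ "as @ [i]"]) (auto simp: reduced_def)
qed

lemma reduced_word_iff:
  assumes "v \<in> S_infty"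
  shows "reduced_word as v \<longleftrightarrow> reduced as \<and> word_perm as = v"
proof
  assume as: "reduced_word as v"
  obtain bs where "reduced bs" "word_perm bs = v"
    using reduced_exists[OF assms] by blast
  with as have "length as \<le> perm_length v"
    by (auto simp: reduced_word_def reduced_def)
  then show "reduced as \<and> word_perm as = v"
    using as perm_length_word_le[of as] by (auto simp: reduced_word_def reduced_def)
next
  assume "reduced as \<and> word_perm as = v"
  then show "reduced_word as v"
    unfolding reduced_word_def reduced_def using perm_length_word_le by metis
qed

lemma reduced_snoc:
  "reduced (as @ [i]) \<longleftrightarrow> 1 \<le> i \<and> reduced as \<and> word_perm as i < word_perm as (Suc i)"
proof (cases "set as \<subseteq> {1..} \<and> 1 \<le> i")
  case True
  then have S: "word_perm as \<in> S_infty"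
    by (simp add: word_perm_S_infty)
  show ?thesis
  proof (cases "word_perm as i < word_perm as (Suc i)")
    case asc: True
    then show ?thesis
      using True perm_length_adj_ascent[OF S asc] by (auto simp: reduced_def word_perm_snoc)
  next
    case False
    then have "perm_length (word_perm as) = Suc (perm_length (word_perm as \<circ> adj i))"
      using S_infty_neq_Suc[OF S, of i] True by (intro perm_length_adj_descent[OF S]) auto
    then show ?thesis
      using False True perm_length_word_le[of as] by (auto simp: reduced_def word_perm_snoc)
  qed
qed (auto simp: reduced_def)

section \<open>Divided differences along words\<close>

abbreviation divdiffs :: "nat list \<Rightarrow> ipoly \<Rightarrow> ipoly" where
  "divdiffs \<equiv> foldr divdiff"

lemma divdiffs_0 [simp]: "divdiffs as 0 = 0"
  by (induction as) auto

lemma divdiffs_diff: "divdiffs as (f - g) = divdiffs as f - divdiffs as g"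
  by (induction as) (auto simp: divdiff_diff)

lemma divdiffs_add: "divdiffs as (f + g) = divdiffs as f + divdiffs as g"
proof -
  have "divdiffs as (f - (0 - g)) = divdiffs as f - (divdiffs as 0 - divdiffs as g)"
    by (simp only: divdiffs_diff)
  then show ?thesis by simp
qed

lemma divdiffs_sum: "divdiffs as (\<Sum>x\<in>A. F x) = (\<Sum>x\<in>A. divdiffs as (F x))"
  by (induction A rule: infinite_finite_induct) (auto simp: divdiffs_add)

lemma divdiffs_mult_invariant:
  assumes "\<And>i. i \<in> set as \<Longrightarrow> swap_vars i g = g"
  shows "divdiffs as (f * g) = divdiffs as f * g"
  using assms by (induction as) (auto simp: divdiff_mult_invariant)

lemma swap_vars_of_int [simp]: "swap_vars i (of_int c) = of_int c"
proof -
  have "swap_exp i k = 0 \<longleftrightarrow> k = 0" for k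
    using total_degree_swap_exp[of i k] by (metis total_degree_eq_0_iff)
  then show ?thesis
    by (intro poly_mapping_eqI) (auto simp: coeff_swap_vars lookup_of_int when_def)
qed

lemma divdiffs_of_int: "divdiffs as (of_int c * f) = of_int c * divdiffs as f"
  using divdiffs_mult_invariant[of as "of_int c" f] by (simp add: mult.commute)

lemma coeff_of_int_mult: "coeff (of_int c * f) k = c * coeff f k"
  using subset_UNIV[of "Poly_Mapping.keys f"]
proof (induction f rule: frag_induction)
  case (one l)
  then show ?case by (simp add: mult_single lookup_single when_def flip: single_of_int)
qed (auto simp: right_diff_distrib lookup_minus)

text \<open>
  If \<open>v\<close> has descents at \<open>i\<close> and at \<open>j\<close>, it has a reduced word ending in \<open>i\<close> and one ending in \<open>j\<close> that differ by
  a single commutation or braid relation: both start with a reduced word of \<open>v\<close> times the longest element of the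
  subgroup generated by \<open>s\<^sub>i\<close> and \<open>s\<^sub>j\<close>.
\<close>
lemma matsumoto_aux:
  assumes v: "v \<in> S_infty" and i: "1 \<le> i" and ij: "i < j"
    and desc: "v (Suc i) < v i" "v (Suc j) < v j"
  obtains as bs where "reduced as" "reduced bs" "word_perm as = v \<circ> adj i" "word_perm bs = v \<circ> adj j"
    "\<And>f. divdiffs (as @ [i]) f = divdiffs (bs @ [j]) f"
proof (cases "Suc i < j")
  case True
  let ?u = "v \<circ> adj i \<circ> adj j"
  have j: "1 \<le> j" using i ij by simp
  have comm: "?u = v \<circ> adj j \<circ> adj i"
    using True by (auto simp: fun_eq_iff transpose_def)
  have "?u \<in> S_infty"
    by (intro S_infty_adj v i j)
  then obtain r where r: "reduced r" "word_perm r = ?u"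
    using reduced_exists by blast
  have w: "word_perm (r @ [j]) = v \<circ> adj i" "word_perm (r @ [i]) = v \<circ> adj j"
    unfolding word_perm_snoc r(2) by (simp, simp add: comm)
  have "perm_length v = Suc (perm_length (v \<circ> adj i))" "perm_length v = Suc (perm_length (v \<circ> adj j))"
    using perm_length_adj_descent[OF v i desc(1)] perm_length_adj_descent[OF v j desc(2)] .
  moreover have "perm_length (v \<circ> adj i) = Suc (perm_length ?u)"
    using True desc by (intro perm_length_adj_descent S_infty_adj v i j) (auto simp: transpose_def)
  ultimately have "reduced (r @ [j])" "reduced (r @ [i])"
    using r(1) i j unfolding reduced_def w by (auto simp: r(2))
  then show ?thesis
    by (rule that) (use w True divdiff_commute[OF True] in auto)
next
  case False
  then have j: "j = Suc i" using ij by simp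
  let ?u = "v \<circ> adj i \<circ> adj j \<circ> adj i"
  have j1: "1 \<le> j" using i j by simp
  have braid: "?u = v \<circ> adj j \<circ> adj i \<circ> adj j"
    by (auto simp: fun_eq_iff transpose_def j)
  have "?u \<in> S_infty"
    by (intro S_infty_adj v i j1)
  then obtain r where r: "reduced r" "word_perm r = ?u"
    using reduced_exists by blast
  have w: "word_perm (r @ [i, j]) = v \<circ> adj i"
    using word_perm_snoc[of "r @ [i]" j] by (simp add: word_perm_snoc r(2))
  have w': "word_perm (r @ [j, i]) = v \<circ> adj j"
    using word_perm_snoc[of "r @ [j]" i] by (simp add: word_perm_snoc r(2) braid)
  have "perm_length v = Suc (perm_length (v \<circ> adj i))" "perm_length v = Suc (perm_length (v \<circ> adj j))"
    using perm_length_adj_descent[OF v i desc(1)] perm_length_adj_descent[OF v j1 desc(2)] .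
  moreover have "perm_length (v \<circ> adj i) = Suc (perm_length (v \<circ> adj i \<circ> adj j))"
    using desc j by (intro perm_length_adj_descent S_infty_adj v i j1) (auto simp: transpose_def)
  moreover have "perm_length (v \<circ> adj i \<circ> adj j) = Suc (perm_length ?u)"
    using desc j by (intro perm_length_adj_descent S_infty_adj v i j1) (auto simp: transpose_def)
  ultimately have "reduced (r @ [i, j])" "reduced (r @ [j, i])"
    using r(1) i j1 unfolding reduced_def w w' by (auto simp: r(2))
  then show ?thesis
    by (rule that) (use w w' divdiff_braid[of i] j in auto)
qed

text \<open>
  Matsumoto's argument: words with the same last letter are compared by induction, and words with different last
  letters are linked through the two words of \<open>matsumoto_aux\<close>, each of which shares its last letter with one of
  them.
\<close>
theorem divdiffs_reduced_unique:
  assumes "reduced as" "reduced bs" "word_perm as = word_perm bs"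
  shows "divdiffs as = divdiffs bs"
  using assms
proof (induction "length as" arbitrary: as bs rule: less_induct)
  case less
  have len: "length as = length bs"
    using less.prems by (simp add: reduced_def)
  show ?case
  proof (cases as rule: rev_cases)
    case Nil
    then show ?thesis using len by simp
  next
    case (snoc as' i)
    then obtain bs' j where bs: "bs = bs' @ [j]"
      using len by (cases bs rule: rev_cases) auto
    define v where "v = word_perm as"
    have v: "v \<in> S_infty" "v = word_perm as' \<circ> adj i" "v = word_perm bs' \<circ> adj j"
      using word_perm_S_infty[OF reduced_letters[OF less.prems(1)]] less.prems(3) snoc bs
      by (simp_all add: v_def word_perm_snoc)
    have r: "reduced as'" "1 \<le> i" "v (Suc i) < v i" "reduced bs'" "1 \<le> j" "v (Suc j) < v j"
    proof -
      show "reduced as'" "1 \<le> i" "reduced bs'" "1 \<le> j"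
        using less.prems(1,2) unfolding snoc bs reduced_snoc by auto
      have "word_perm as' i < word_perm as' (Suc i)" "word_perm bs' j < word_perm bs' (Suc j)"
        using less.prems(1,2) unfolding snoc bs reduced_snoc by auto
      then show "v (Suc i) < v i" "v (Suc j) < v j"
        by (simp add: v(2), simp add: v(3))
    qed
    have w: "word_perm as' = v \<circ> adj i" "word_perm bs' = v \<circ> adj j"
      using v by (metis adj_adj)+
    have IH: "divdiffs as' = divdiffs cs" if "reduced cs" "word_perm cs = v \<circ> adj i" for cs
      using less.hyps[of as' cs] snoc r that w by auto
    have IH': "divdiffs bs' = divdiffs cs" if "reduced cs" "word_perm cs = v \<circ> adj j" for cs
      using less.hyps[of bs' cs] bs len snoc r that w by auto
    consider "i = j" | "i < j" | "j < i" by linarith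
    then show ?thesis
    proof cases
      case 1
      then show ?thesis using IH[of bs'] r w by (simp add: snoc bs fun_eq_iff)
    next
      case 2
      obtain cs ds where "reduced cs" "reduced ds" "word_perm cs = v \<circ> adj i" "word_perm ds = v \<circ> adj j"
        "\<And>f. divdiffs (cs @ [i]) f = divdiffs (ds @ [j]) f"
        using matsumoto_aux[OF v(1) r(2) 2 r(3) r(6)] by blast
      then show ?thesis using IH[of cs] IH'[of ds] by (simp add: snoc bs fun_eq_iff)
    next
      case 3
      obtain cs ds where "reduced cs" "reduced ds" "word_perm cs = v \<circ> adj j" "word_perm ds = v \<circ> adj i"
        "\<And>f. divdiffs (cs @ [j]) f = divdiffs (ds @ [i]) f"
        using matsumoto_aux[OF v(1) r(5) 3 r(6) r(3)] by blast
      then show ?thesis using IH[of ds] IH'[of cs] by (simp add: snoc bs fun_eq_iff)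
    qed
  qed
qed

lemma divdiff_perm_eq:
  assumes "reduced as" "word_perm as = v"
  shows "divdiff_perm v = divdiffs as"
proof -
  have v: "v \<in> S_infty"
    using assms word_perm_S_infty reduced_letters by blast
  have "reduced_word (SOME as. reduced_word as v) v"
    by (rule someI) (use assms reduced_word_iff[OF v, of as] in blast)
  then show ?thesis
    unfolding divdiff_perm_def
    by (intro divdiffs_reduced_unique) (use assms reduced_word_iff[OF v] in simp_all)
qed

text \<open>
  At the first place where reducedness fails, the prefix can be replaced by a reduced word ending in the next
  letter, and \<open>\<partial>\<^sub>i \<partial>\<^sub>i = 0\<close>.
\<close>
lemma divdiffs_not_reduced:
  assumes "set as \<subseteq> {1..}" "\<not> reduced as"
  shows "divdiffs as f = 0"
  using assms
proof (induction as arbitrary: f rule: rev_induct)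
  case Nil
  then show ?case by (simp add: reduced_def)
next
  case (snoc i as)
  show ?case
  proof (cases "reduced as")
    case False
    then show ?thesis using snoc by simp
  next
    case True
    let ?v = "word_perm as"
    have v: "?v \<in> S_infty" using True reduced_letters word_perm_S_infty by blast
    have i: "1 \<le> i" using snoc by simp
    have "?v (Suc i) < ?v i"
      using snoc(3) True i S_infty_neq_Suc[OF v, of i] by (auto simp: reduced_snoc)
    obtain bs where bs: "reduced bs" "word_perm bs = ?v \<circ> adj i"
      using reduced_exists[OF S_infty_adj[OF v i]] by blast
    have "reduced (bs @ [i])"
      using bs i \<open>?v (Suc i) < ?v i\<close> by (simp add: reduced_snoc)
    moreover have "word_perm (bs @ [i]) = ?v"
      by (simp add: word_perm_snoc bs)
    ultimately have "divdiffs as = divdiffs (bs @ [i])"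
      by (intro divdiffs_reduced_unique True) simp_all
    then show ?thesis by simp
  qed
qed

section \<open>Variables, degrees and vanishing\<close>

definition polys :: "nat set \<Rightarrow> ipoly set" where
  "polys A = {f. \<forall>k\<in>Poly_Mapping.keys f. Poly_Mapping.keys k \<subseteq> A}"

lemma polysD: "f \<in> polys A \<Longrightarrow> k \<in> Poly_Mapping.keys f \<Longrightarrow> j \<notin> A \<Longrightarrow> expo k j = 0"
  unfolding polys_def by (metis (mono_tags, lifting) in_keys_iff mem_Collect_eq subsetD)

lemma polys_mono: "A \<subseteq> B \<Longrightarrow> polys A \<subseteq> polys B"
  by (auto simp: polys_def)

lemma polys_0 [simp]: "0 \<in> polys A"
  by (simp add: polys_def)

lemma polys_1 [simp]: "1 \<in> polys A"
  by (simp add: polys_def)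

lemma polys_diff: "f \<in> polys A \<Longrightarrow> g \<in> polys A \<Longrightarrow> f - g \<in> polys A"
  using keys_diff[of f g] by (auto simp: polys_def)

lemma polys_add: "f \<in> polys A \<Longrightarrow> g \<in> polys A \<Longrightarrow> f + g \<in> polys A"
  using keys_add[of f g] by (auto simp: polys_def)

lemma polys_mult: "f \<in> polys A \<Longrightarrow> g \<in> polys A \<Longrightarrow> f * g \<in> polys A"
  unfolding polys_def
proof clarify
  fix k j assume *: "\<forall>k\<in>Poly_Mapping.keys f. Poly_Mapping.keys k \<subseteq> A"
    "\<forall>k\<in>Poly_Mapping.keys g. Poly_Mapping.keys k \<subseteq> A"
    "k \<in> Poly_Mapping.keys (f * g)" "j \<in> Poly_Mapping.keys k"
  then obtain a b where "k = a + b" "a \<in> Poly_Mapping.keys f" "b \<in> Poly_Mapping.keys g"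
    using keys_mult[of f g] by blast
  then show "j \<in> A"
    using * keys_add[of a b] by blast
qed

lemma polys_sum: "(\<And>x. x \<in> X \<Longrightarrow> F x \<in> polys A) \<Longrightarrow> (\<Sum>x\<in>X. F x) \<in> polys A"
  by (induction X rule: infinite_finite_induct) (auto intro: polys_add)

lemma polys_prod: "(\<And>x. x \<in> X \<Longrightarrow> F x \<in> polys A) \<Longrightarrow> (\<Prod>x\<in>X. F x) \<in> polys A"
  by (induction X rule: infinite_finite_induct) (auto intro: polys_mult)

lemma polys_power: "f \<in> polys A \<Longrightarrow> f ^ n \<in> polys A"
  by (induction n) (auto intro: polys_mult)

lemma polys_Var: "i \<in> A \<Longrightarrow> Var i \<in> polys A"
  by (auto simp: polys_def Var_def)

lemma polys_of_int: "of_int c \<in> polys A"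
  by (auto simp: polys_def simp flip: single_of_int split: if_splits)

lemma polys_divdiff:
  assumes "f \<in> polys A"
  shows "divdiff i f \<in> polys (A \<union> {i, Suc i})"
  unfolding polys_def
proof (intro CollectI ballI subsetI)
  fix k' j assume k': "k' \<in> Poly_Mapping.keys (divdiff i f)" "j \<in> Poly_Mapping.keys k'"
  then obtain k where k: "k \<in> Poly_Mapping.keys f" "lowered i k' k"
    using keys_divdiff by blast
  have "j \<in> A" if "j \<notin> {i, Suc i}"
  proof -
    have "expo k j = expo k' j"
      using k(2) that by (simp add: lowered_def)
    then show ?thesis
      using polysD[OF assms k(1), of j] k'(2) by (auto simp: in_keys_iff)
  qed
  then show "j \<in> A \<union> {i, Suc i}" by blast
qed

lemma polys_divdiffs:
  assumes "f \<in> polys {1..}" "set as \<subseteq> {1..}"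
  shows "divdiffs as f \<in> polys {1..}"
  using assms(2)
proof (induction as)
  case (Cons i as)
  then have "divdiff i (divdiffs as f) \<in> polys ({1..} \<union> {i, Suc i})"
    by (intro polys_divdiff) auto
  moreover have "{1..} \<union> {i, Suc i} = {1..}"
    using Cons by auto
  ultimately show ?case by simp
qed (use assms in simp)

lemma keys_divdiffs:
  "k' \<in> Poly_Mapping.keys (divdiffs as f) \<Longrightarrow> \<exists>k\<in>Poly_Mapping.keys f. total_degree k = length as + total_degree k'"
proof (induction as arbitrary: k')
  case (Cons i as)
  then show ?case
    using keys_divdiff[of k' i "divdiffs as f"] by (fastforce simp: lowered_def)
qed auto

text \<open>
  Otherwise let \<open>M > m\<close> be the largest index of a variable in \<open>f\<close>; exchanging \<open>x\<^sub>M\<close> and \<open>x\<^sub>M\<^sub>+\<^sub>1\<close> would produce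
  a monomial of \<open>f\<close> with a larger index.
\<close>
lemma invariant_beyond:
  assumes f: "f \<in> polys {1..}" and inv: "\<And>i. m < i \<Longrightarrow> swap_vars i f = f"
  shows "f \<in> polys {1..m}"
proof -
  define J where "J = (\<Union>k\<in>Poly_Mapping.keys f. Poly_Mapping.keys k)"
  have fin: "finite J" by (auto simp: J_def)
  have "j \<le> m" if "j \<in> J" for j
  proof (rule ccontr)
    assume "\<not> j \<le> m"
    define M where "M = Max J"
    have M: "M \<in> J" "m < M"
    proof -
      show "M \<in> J" using Max_in[OF fin] that by (auto simp: M_def)
      show "m < M" using Max_ge[OF fin that] \<open>\<not> j \<le> m\<close> unfolding M_def by linarith
    qed
    then obtain k where k: "k \<in> Poly_Mapping.keys f" "M \<in> Poly_Mapping.keys k"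
      by (auto simp: J_def)
    have "coeff f (swap_exp M k) = coeff f k"
      using inv[OF M(2)] coeff_swap_vars[of M f k] by simp
    then have "swap_exp M k \<in> Poly_Mapping.keys f"
      using k by (simp add: in_keys_iff)
    moreover have "Suc M \<in> Poly_Mapping.keys (swap_exp M k)"
      using k by (simp add: in_keys_iff expo_swap_exp)
    ultimately have "Suc M \<in> J"
      by (auto simp: J_def)
    then show False
      using Max_ge[OF fin, of "Suc M"] by (simp add: M_def)
  qed
  moreover have "1 \<le> j" if "j \<in> J" for j
    using that f by (fastforce simp: J_def polys_def)
  ultimately show ?thesis
    unfolding polys_def J_def by (simp add: subset_iff) blast
qed

lemma divdiff_polys_eq_0:
  assumes "f \<in> polys {1..n}" "n < i"
  shows "divdiff i f = 0"
proof -
  have "swap_exp i k = k" if "k \<in> Poly_Mapping.keys f" for k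
    using that assms polysD[OF assms(1) that, of i] polysD[OF assms(1) that, of "Suc i"]
    by (intro poly_mapping_eqI) (auto simp: expo_swap_exp transpose_def)
  then have "swap_vars i f = f"
    by (intro poly_mapping_eqI) (metis coeff_swap_vars in_keys_iff swap_exp_involutory)
  then show ?thesis by (simp add: divdiff_eq_0_iff)
qed

text \<open>
  Each factor lowers the degree and can introduce one new variable, and \<open>\<partial>\<^sub>i\<close> kills polynomials in
  \<open>x\<^sub>1, \<dots>, x\<^sub>n\<close> for \<open>i > n\<close>.  Hence only finitely many permutations contribute to the expansion of \<open>f\<close> in the
  Schubert basis.
\<close>
lemma divdiffs_nonzero_bound:
  assumes "f \<in> polys {1..n}" "\<And>k. k \<in> Poly_Mapping.keys f \<Longrightarrow> total_degree k \<le> d"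
    "set as \<subseteq> {1..}" "divdiffs as f \<noteq> 0"
  shows "set as \<subseteq> {1..n + d}"
  using assms
proof (induction as arbitrary: f n d rule: rev_induct)
  case (snoc i as)
  have nz: "divdiff i f \<noteq> 0"
    using snoc.prems by auto
  then have i: "1 \<le> i" "i \<le> n"
    using divdiff_polys_eq_0[OF snoc.prems(1), of i] snoc.prems(3) leI by auto
  have deg: "Suc (total_degree k) \<le> d" if "k \<in> Poly_Mapping.keys (divdiff i f)" for k
    using keys_divdiff[OF that] snoc.prems(2) by (fastforce simp: lowered_def)
  obtain k where "k \<in> Poly_Mapping.keys (divdiff i f)"
    using nz by (metis all_not_in_conv keys_eq_empty)
  from deg[OF this] obtain d' where d': "d = Suc d'"
    by (cases d) auto
  have "divdiff i f \<in> polys ({1..n} \<union> {i, Suc i})"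
    by (rule polys_divdiff) (rule snoc)
  then have "divdiff i f \<in> polys {1..Suc n}"
    using polys_mono[of "{1..n} \<union> {i, Suc i}" "{1..Suc n}"] i by auto
  then have "set as \<subseteq> {1..Suc n + d'}"
    by (rule snoc.IH) (use deg d' snoc.prems in auto)
  then show ?case using i d' by auto
qed simp

text \<open>
  By induction on the degree all \<open>\<partial>\<^sub>i f\<close> vanish, so \<open>f\<close> is symmetric in all of the infinitely many variables
  and therefore constant.
\<close>
lemma divdiffs_const_terms_zero:
  assumes "f \<in> polys {1..}" "\<And>as. set as \<subseteq> {1..} \<Longrightarrow> coeff (divdiffs as f) 0 = 0"
  shows "f = 0"
proof -
  have "f = 0" if "\<And>k. k \<in> Poly_Mapping.keys f \<Longrightarrow> total_degree k < d" for d
    using assms that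
  proof (induction d arbitrary: f)
    case 0
    then have "Poly_Mapping.keys f = {}" by blast
    then show ?case by (simp only: keys_eq_empty)
  next
    case (Suc d)
    have "divdiff i f = 0" if "1 \<le> i" for i
    proof (rule Suc.IH)
      show "divdiff i f \<in> polys {1..}"
        using polys_divdiffs[OF Suc.prems(1), of "[i]"] that by simp
      show "coeff (divdiffs as (divdiff i f)) 0 = 0" if "set as \<subseteq> {1..}" for as
        using Suc.prems(2)[of "as @ [i]"] that \<open>1 \<le> i\<close> by simp
      show "total_degree k < d" if "k \<in> Poly_Mapping.keys (divdiff i f)" for k
        using keys_divdiff[OF that] Suc.prems(3) by (fastforce simp: lowered_def)
    qed
    then have "f \<in> polys {1..0}"
      by (intro invariant_beyond Suc.prems) (simp add: divdiff_eq_0_iff)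
    then have "k = 0" if "k \<in> Poly_Mapping.keys f" for k
      using that by (auto simp: polys_def)
    moreover have "coeff f 0 = 0"
      using Suc.prems(2)[of "[]"] by simp
    ultimately have "Poly_Mapping.keys f = {}"
      by (metis all_not_in_conv in_keys_iff)
    then show ?case by (simp only: keys_eq_empty)
  qed
  from this[of "Suc (Max (total_degree ` Poly_Mapping.keys f))"] show ?thesis
    by (simp add: le_imp_less_Suc)
qed

section \<open>Schubert polynomials\<close>

lemma word_perm_rev: "word_perm (rev as) = inv (word_perm as)"
proof (induction as)
  case (Cons i as)
  have "bij (word_perm as)"
  proof (induction as)
    case (Cons j as)
    then have "bij (adj j \<circ> word_perm as)"
      by (intro bij_comp) auto
    then show ?case by (simp only: word_perm_Cons)
  qed (simp only: word_perm_Nil bij_id)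
  then have "inv (adj i \<circ> word_perm as) = inv (word_perm as) \<circ> adj i"
    by (subst o_inv_distrib) (auto simp: inv_transpose_eq)
  then have "word_perm (rev (i # as)) = inv (word_perm (i # as))"
    unfolding rev.simps word_perm_snoc word_perm_Cons Cons.IH by (rule sym)
  then show ?case .
qed (simp only: rev.simps word_perm_Nil inv_id)

lemma perm_length_inv_le: "v \<in> S_infty \<Longrightarrow> perm_length (inv v) \<le> perm_length v"
proof -
  assume "v \<in> S_infty"
  then obtain as where "reduced as" "word_perm as = v"
    using reduced_exists by blast
  then show ?thesis
    using perm_length_word_le[of "rev as"] by (simp add: word_perm_rev reduced_def)
qed

lemma perm_length_inv: "v \<in> S_infty \<Longrightarrow> perm_length (inv v) = perm_length v"
  using perm_length_inv_le[of v] perm_length_inv_le[of "inv v"] S_infty_inv[of v] S_infty_bij[of v]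
  by (simp add: inv_inv_eq)

lemma reduced_rev: "reduced (rev as) \<longleftrightarrow> reduced as"
  using perm_length_inv[of "word_perm as"] word_perm_S_infty[of as]
  by (auto simp: reduced_def word_perm_rev)

lemma reduced_Cons:
  "reduced (i # as) \<longleftrightarrow> 1 \<le> i \<and> reduced as \<and> inv (word_perm as) i < inv (word_perm as) (Suc i)"
  using reduced_snoc[of "rev as" i] reduced_rev[of "i # as"] reduced_rev[of as] by (simp add: word_perm_rev)

lemma longest_perm_permutes: "longest_perm n permutes {1..n}"
proof (rule bij_imp_permutes)
  show "bij_betw (longest_perm n) {1..n} {1..n}"
    by (rule bij_betw_byWitness[where f' = "longest_perm n"]) (auto simp: longest_perm_def)
qed (auto simp: longest_perm_def)

lemma longest_perm_involutory [simp]: "longest_perm n \<circ> longest_perm n = id"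
  by (auto simp: longest_perm_def fun_eq_iff)

lemma inv_longest_perm [simp]: "inv (longest_perm n) = longest_perm n"
  by (rule inv_unique_comp) auto

definition staircase :: "nat \<Rightarrow> ipoly" where
  "staircase n = (\<Prod>i\<in>{1..<n}. Var i ^ (n - i))"

lemma inv_comp_longest_permutes: "u permutes {1..n} \<Longrightarrow> inv u \<circ> longest_perm n permutes {1..n}"
  by (intro permutes_compose longest_perm_permutes permutes_inv)

lemma schubert_in_eq:
  assumes "reduced as" "word_perm as = inv u \<circ> longest_perm n"
  shows "schubert_in n u = divdiffs as (staircase n)"
  using divdiff_perm_eq[OF assms] by (simp add: schubert_in_def staircase_def)

lemma schubert_in_word:
  assumes "u permutes {1..n}"
  obtains as where "reduced as" "word_perm as = inv u \<circ> longest_perm n"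
  using reduced_exists inv_comp_longest_permutes[OF assms] unfolding S_infty_iff by blast

text \<open>
  Prepending \<open>i\<close> to a reduced word of \<open>u\<inverse> \<omega>\<^sub>n\<close> gives a word of \<open>(u s\<^sub>i)\<inverse> \<omega>\<^sub>n\<close>, which is reduced exactly when
  \<open>\<omega>\<^sub>n u\<close> ascends at \<open>i\<close>, that is, when \<open>u\<close> descends there.
\<close>
lemma divdiff_schubert_in:
  assumes u: "u permutes {1..n}" and i: "1 \<le> i" "i < n"
  shows "divdiff i (schubert_in n u) = (if u (Suc i) < u i then schubert_in n (u \<circ> adj i) else 0)"
proof -
  obtain as where as: "reduced as" "word_perm as = inv u \<circ> longest_perm n"
    using schubert_in_word[OF u] .
  have bij: "bij u" "bij (longest_perm n)"
    using permutes_bij u longest_perm_permutes by blast+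
  have "inv (word_perm as) = longest_perm n \<circ> u"
    unfolding as(2) using bij by (simp add: o_inv_distrib bij_imp_bij_inv inv_inv_eq)
  moreover have "longest_perm n (u i) < longest_perm n (u (Suc i)) \<longleftrightarrow> u (Suc i) < u i"
    using permutes_in_image[OF u, of i] permutes_in_image[OF u, of "Suc i"] i
    by (auto simp: longest_perm_def)
  ultimately have red: "reduced (i # as) \<longleftrightarrow> u (Suc i) < u i"
    using as(1) i by (simp add: reduced_Cons)
  have D: "divdiff i (schubert_in n u) = divdiffs (i # as) (staircase n)"
    using schubert_in_eq[OF as] by simp
  show ?thesis
  proof (cases "u (Suc i) < u i")
    case True
    have "word_perm (i # as) = inv (u \<circ> adj i) \<circ> longest_perm n"
      using bij by (simp add: as(2) o_inv_distrib inv_transpose_eq comp_assoc)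
    then show ?thesis
      using True red schubert_in_eq[of "i # as" "u \<circ> adj i" n] D by simp
  next
    case False
    then show ?thesis
      using divdiffs_not_reduced[of "i # as"] red D as(1) i reduced_letters[of as] by simp
  qed
qed

lemma word_perm_block:
  "k \<le> V \<Longrightarrow> word_perm (rev [k..<V]) j = (if j = k then V else if k < j \<and> j \<le> V then j - 1 else j)"
proof (induction V rule: dec_induct)
  case (step V)
  then have "word_perm (rev [k..<Suc V]) j = adj V (word_perm (rev [k..<V]) j)"
    by simp
  then show ?case using step by (auto simp: transpose_def)
qed auto

lemma swap_vars_prod: "swap_vars i (\<Prod>x\<in>X. F x) = (\<Prod>x\<in>X. swap_vars i (F x))"
  by (induction X rule: infinite_finite_induct) (auto simp: swap_vars_mult)

lemma swap_vars_power: "swap_vars i (f ^ n) = swap_vars i f ^ n"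
  by (induction n) (auto simp: swap_vars_mult)

lemma divdiff_Var: "divdiff i (Var i) = 1"
  by (rule divdiff_unique) (simp add: swap_vars_Var)

text \<open>
  In each step the current monomial is \<open>x\<^sub>k\<close> times one that is symmetric in \<open>x\<^sub>k\<close> and \<open>x\<^sub>k\<^sub>+\<^sub>1\<close>, and
  \<open>\<partial>\<^sub>k x\<^sub>k = 1\<close>.
\<close>
lemma divdiffs_staircase:
  "divdiffs (rev [1..<Suc n]) (staircase (Suc n)) = staircase n"
proof -
  define e where "e k i = (if i < k then n - i else Suc n - i)" for k i :: nat
  \<comment> \<open>\<open>P k\<close> is the monomial reached after \<open>\<partial>\<^sub>k\<^sub>-\<^sub>1 \<dots> \<partial>\<^sub>1\<close>.\<close>
  define P where "P k = (\<Prod>i\<in>{1..Suc n}. Var i ^ e k i)" for k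
  have step: "divdiff k (P k) = P (Suc k)" if k: "1 \<le> k" "k \<le> n" for k
  proof -
    have split: "P j = Var k ^ e j k * (\<Prod>i\<in>{1..Suc n} - {k}. Var i ^ e j i)" for j
      unfolding P_def by (subst prod.remove[of _ k]) (use k in auto)
    have "(\<Prod>i\<in>{1..Suc n} - {k}. Var i ^ e k i) = (\<Prod>i\<in>{1..Suc n} - {k}. Var i ^ e (Suc k) i)"
      by (rule prod.cong) (auto simp: e_def)
    then have "P k = Var k * P (Suc k)"
      using k unfolding split[of k] split[of "Suc k"] by (simp add: e_def Suc_diff_le)
    moreover have "swap_vars k (P (Suc k)) = P (Suc k)"
      unfolding P_def swap_vars_prod swap_vars_power swap_vars_Var
      by (rule prod.reindex_bij_witness[of _ "adj k" "adj k"])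
         (use k in \<open>auto simp: transpose_def e_def Suc_diff_le\<close>)
    ultimately show ?thesis
      by (simp add: divdiff_mult_invariant divdiff_Var)
  qed
  have "divdiffs (rev [1..<Suc k]) (P 1) = P (Suc k)" if "k \<le> n" for k
    using that
  proof (induction k)
    case (Suc k)
    then show ?case using step[of "Suc k"] by simp
  qed simp
  from this[of n] have "divdiffs (rev [1..<Suc n]) (P 1) = P (Suc n)" by simp
  moreover have "P 1 = staircase (Suc n)"
    unfolding P_def staircase_def
    by (rule prod.mono_neutral_cong_right) (auto simp: e_def)
  moreover have "P (Suc n) = staircase n"
    unfolding P_def staircase_def
    by (rule prod.mono_neutral_cong_right) (auto simp: e_def)
  ultimately show ?thesis by simp
qed

text \<open>
  Since \<open>\<omega>\<^sub>n\<^sub>+\<^sub>1 = \<omega>\<^sub>n s\<^sub>n \<dots> s\<^sub>1\<close>, a reduced word for \<open>n\<close> extends by \<open>n, \<dots>, 1\<close> to one for \<open>n + 1\<close>, and these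
  letters turn one staircase monomial into the other.
\<close>
lemma schubert_in_Suc:
  assumes u: "u permutes {1..n}"
  shows "schubert_in (Suc n) u = schubert_in n u"
proof -
  obtain as where as: "reduced as" "word_perm as = inv u \<circ> longest_perm n"
    using schubert_in_word[OF u] .
  have y: "word_perm as permutes {1..n}"
    unfolding as(2) using u by (rule inv_comp_longest_permutes)
  have "reduced (as @ rev [k..<Suc n])" if "k \<le> Suc n" "1 \<le> k" for k
    using that
  proof (induction rule: inc_induct)
    case base
    then show ?case using as by simp
  next
    case (step k)
    then have eq: "as @ rev [k..<Suc n] = (as @ rev [Suc k..<Suc n]) @ [k]"
      by (simp add: upt_conv_Cons)
    have "word_perm as k \<le> n"
      using permutes_in_image[OF y, of k] step by auto
    moreover have "word_perm as (Suc n) = Suc n"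
      using permutes_not_in[OF y] by auto
    ultimately show ?case
      unfolding eq reduced_snoc using step
      by (simp add: word_perm_append word_perm_block del: upt_Suc)
  qed
  from this[of 1] have "reduced (as @ rev [1..<Suc n])" by simp
  moreover have "word_perm (as @ rev [1..<Suc n]) = inv u \<circ> longest_perm (Suc n)"
    unfolding word_perm_append as(2) comp_assoc
    by (rule arg_cong[where f = "(\<circ>) (inv u)"])
       (auto simp: fun_eq_iff word_perm_block longest_perm_def simp del: upt_Suc)
  ultimately have "schubert_in (Suc n) u = divdiffs (as @ rev [1..<Suc n]) (staircase (Suc n))"
    by (rule schubert_in_eq)
  then show ?thesis
    using schubert_in_eq[OF as] divdiffs_staircase[of n] by (simp del: upt_Suc)
qed

lemma schubert_eq_schubert_in:
  assumes u: "u permutes {1..n}"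
  shows "schubert u = schubert_in n u"
proof -
  let ?m = "LEAST n. u permutes {1..n}"
  have "?m \<le> n" using u by (rule Least_le)
  then have "schubert_in n u = schubert_in ?m u"
  proof (induction rule: dec_induct)
    case (step k)
    have "u permutes {1..?m}" using u by (rule LeastI)
    then have "u permutes {1..k}"
      by (rule permutes_subset) (use step in auto)
    then show ?case using schubert_in_Suc step by simp
  qed simp
  then show ?thesis by (simp add: schubert_def)
qed

lemma divdiff_schubert:
  assumes u: "u \<in> S_infty" and i: "1 \<le> i"
  shows "divdiff i (schubert u) = (if u (Suc i) < u i then schubert (u \<circ> adj i) else 0)"
proof -
  obtain n where n: "u permutes {1..n}" "adj i permutes {1..n}"
    using S_infty_common[OF u adj_S_infty[OF i]] .
  have "i < n"
  proof (rule ccontr)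
    assume "\<not> i < n"
    then show False
      using permutes_not_in[OF n(2), of "Suc i"] by simp
  qed
  then show ?thesis
    using divdiff_schubert_in[OF n(1) i] schubert_eq_schubert_in n permutes_compose by metis
qed

lemma schubert_id: "schubert id = 1"
proof -
  have "id permutes {1..0::nat}" by (simp add: permutes_id)
  then have "schubert id = schubert_in 0 id"
    by (rule schubert_eq_schubert_in)
  moreover have "longest_perm 0 = id"
    by (auto simp: longest_perm_def fun_eq_iff)
  ultimately show ?thesis
    using schubert_in_eq[of "[]" id 0] by (simp add: reduced_def staircase_def)
qed

lemma schubert_polys: "u \<in> S_infty \<Longrightarrow> schubert u \<in> polys {1..}"
proof -
  assume "u \<in> S_infty"
  then obtain n where n: "u permutes {1..n}"
    by (auto simp: S_infty_iff)
  obtain as where as: "reduced as" "word_perm as = inv u \<circ> longest_perm n"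
    using schubert_in_word[OF n] .
  have "staircase n \<in> polys {1..}"
    unfolding staircase_def by (intro polys_prod polys_power polys_Var) auto
  then show ?thesis
    using schubert_eq_schubert_in[OF n] schubert_in_eq[OF as] reduced_letters[OF as(1)] polys_divdiffs
    by simp
qed

lemma prod_Var_power: "(\<Prod>i\<in>I. Var i ^ e i) = frag_of (\<Sum>i\<in>I. Poly_Mapping.single i (e i))"
  by (induction I rule: infinite_finite_induct) (auto simp: Var_power mult_single)

lemma schubert_homogeneous:
  assumes "u \<in> S_infty"
  obtains d where "\<And>k. k \<in> Poly_Mapping.keys (schubert u) \<Longrightarrow> total_degree k = d"
proof -
  obtain n where n: "u permutes {1..n}"
    using assms by (auto simp: S_infty_iff)
  obtain as where as: "reduced as" "word_perm as = inv u \<circ> longest_perm n"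
    using schubert_in_word[OF n] .
  let ?K = "\<Sum>i\<in>{1..<n}. Poly_Mapping.single i (n - i)"
  have "total_degree k = total_degree ?K - length as" if "k \<in> Poly_Mapping.keys (schubert u)" for k
    using keys_divdiffs[of k as "staircase n"] that
    by (simp add: schubert_eq_schubert_in[OF n] schubert_in_eq[OF as] staircase_def prod_Var_power)
  then show ?thesis by (rule that)
qed

section \<open>Duality and the Schubert expansion\<close>

lemma divdiffs_schubert_same:
  "reduced as \<Longrightarrow> divdiffs as (schubert (word_perm as)) = 1"
proof (induction as rule: rev_induct)
  case (snoc i as)
  then have "1 \<le> i" "reduced as" "word_perm as i < word_perm as (Suc i)"
    by (auto simp: reduced_snoc)
  moreover have "word_perm (as @ [i]) \<in> S_infty"
    using snoc.prems reduced_letters word_perm_S_infty by blast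
  ultimately have "divdiff i (schubert (word_perm (as @ [i]))) = schubert (word_perm as)"
    using divdiff_schubert[of "word_perm (as @ [i])" i] by (simp add: word_perm_snoc)
  then show ?case
    using snoc.IH \<open>reduced as\<close> by simp
qed (simp only: schubert_id word_perm_Nil foldr_Nil id_apply)

text \<open>
  A reduced word of \<open>u\<close> lowers the homogeneous polynomial \<open>\<SS>\<^sub>u\<close> to \<open>1\<close>, so its degree is the length of that word.
\<close>
lemma schubert_const_term:
  assumes u: "u \<in> S_infty"
  shows "coeff (schubert u) 0 = (if u = id then 1 else 0)"
proof (cases "u = id")
  case False
  obtain as where as: "reduced as" "word_perm as = u"
    using reduced_exists[OF u] by blast
  have deg: "\<exists>k\<in>Poly_Mapping.keys (schubert u). total_degree k = length as + total_degree 0"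
    using keys_divdiffs[of 0 as "schubert u"] divdiffs_schubert_same[OF as(1)] as(2) by simp
  have "length as \<noteq> 0"
    using False as by auto
  have "0 \<notin> Poly_Mapping.keys (schubert u)"
  proof (intro notI)
    assume "0 \<in> Poly_Mapping.keys (schubert u)"
    moreover obtain d where "\<And>k. k \<in> Poly_Mapping.keys (schubert u) \<Longrightarrow> total_degree k = d"
      using schubert_homogeneous[OF u] by blast
    ultimately show False
      using deg \<open>length as \<noteq> 0\<close> by fastforce
  qed
  then show ?thesis
    using False by (simp add: in_keys_iff)
qed (simp add: schubert_id)

lemma divdiffs_schubert_dual:
  assumes "reduced as" "u \<in> S_infty"
  shows "coeff (divdiffs as (schubert u)) 0 = (if u = word_perm as then 1 else 0)"
  using assms
proof (induction as arbitrary: u rule: rev_induct)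
  case Nil
  then show ?case by (simp only: schubert_const_term word_perm_Nil foldr.simps id_def)
next
  case (snoc i as)
  then have i: "1 \<le> i" and as: "reduced as" "word_perm as i < word_perm as (Suc i)"
    by (auto simp: reduced_snoc)
  have IH: "coeff (divdiffs as (schubert v)) 0 = (if v = word_perm as then 1 else 0)"
    if "v \<in> S_infty" for v
    using snoc.IH[OF as(1) that] .
  have "coeff (divdiffs (as @ [i]) (schubert u)) 0 = (if u = word_perm (as @ [i]) then 1 else 0)"
  proof (cases "u (Suc i) < u i")
    case True
    have "u = word_perm as \<circ> adj i \<longleftrightarrow> u \<circ> adj i = word_perm as"
      by (metis adj_adj)
    then show ?thesis
      using IH[OF S_infty_adj[OF snoc.prems(2) i]] True
      by (simp add: divdiff_schubert[OF snoc.prems(2) i] word_perm_snoc)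
  next
    case False
    then have "u \<noteq> word_perm (as @ [i])"
      using as(2) by (auto simp: word_perm_snoc)
    then show ?thesis
      using False by (simp add: divdiff_schubert[OF snoc.prems(2) i])
  qed
  then show ?case .
qed

lemma polys_finitely_many_vars:
  assumes "f \<in> polys {1..}"
  obtains n where "f \<in> polys {1..n}"
proof -
  define J where "J = (\<Union>k\<in>Poly_Mapping.keys f. Poly_Mapping.keys k)"
  have "finite J" by (auto simp: J_def)
  then have "J \<subseteq> {..Max J}" by auto
  moreover have "J \<subseteq> {1..}"
    using assms by (auto simp: J_def polys_def)
  ultimately have "J \<subseteq> {1..Max J}" by auto
  then have "f \<in> polys {1..Max J}"
    unfolding polys_def J_def by (simp add: UN_subset_iff)
  then show ?thesis by (rule that)
qed

lemma word_perm_permutes: "set as \<subseteq> {1..n} \<Longrightarrow> word_perm as permutes {1..Suc n}"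
  by (induction as) (use permutes_id in \<open>auto intro!: permutes_compose adj_permutes[simplified]\<close>)

text \<open>
  The difference of \<open>f\<close> and the sum has iterated divided differences with constant term zero only: along reduced
  words by duality, along all other words because they act as zero.
\<close>
theorem schubert_expansion:
  assumes f: "f \<in> polys {1..}"
  obtains c where "Poly_Mapping.keys c \<subseteq> S_infty"
    "\<And>v. v \<in> S_infty \<Longrightarrow> Poly_Mapping.lookup c v = coeff (divdiff_perm v f) 0"
    "f = (\<Sum>z\<in>Poly_Mapping.keys c. of_int (Poly_Mapping.lookup c z) * schubert z)"
proof -
  define g where "g v = (if v \<in> S_infty then coeff (divdiff_perm v f) 0 else 0)" for v
  obtain n where n: "f \<in> polys {1..n}"
    using polys_finitely_many_vars[OF f] .
  define d where "d = Max (total_degree ` Poly_Mapping.keys f)"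
  have d: "total_degree k \<le> d" if "k \<in> Poly_Mapping.keys f" for k
    using that by (simp add: d_def)
  have "{v. g v \<noteq> 0} \<subseteq> {v. v permutes {1..Suc (n + d)}}"
  proof clarify
    fix v assume "g v \<noteq> 0"
    then have v: "v \<in> S_infty" "coeff (divdiff_perm v f) 0 \<noteq> 0"
      by (auto simp: g_def split: if_splits)
    obtain as where as: "reduced as" "word_perm as = v"
      using reduced_exists[OF v(1)] by blast
    have "divdiffs as f \<noteq> 0"
      using v(2) divdiff_perm_eq[OF as] by auto
    then have "set as \<subseteq> {1..n + d}"
      by (intro divdiffs_nonzero_bound[OF n d]) (use as reduced_letters in auto)
    then show "v permutes {1..Suc (n + d)}"
      using word_perm_permutes as(2) by blast
  qed
  then have fin: "finite {v. g v \<noteq> 0}"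
    using finite_permutations[of "{1..Suc (n + d)}"] finite_subset by blast
  define c where "c = Abs_poly_mapping g"
  have lookup_c: "Poly_Mapping.lookup c = g"
    using fin by (simp add: c_def)
  have c1: "Poly_Mapping.keys c \<subseteq> S_infty"
    by (auto simp: in_keys_iff lookup_c g_def split: if_splits)
  let ?S = "\<Sum>z\<in>Poly_Mapping.keys c. of_int (Poly_Mapping.lookup c z) * schubert z"
  have "f - ?S = 0"
  proof (rule divdiffs_const_terms_zero)
    show "f - ?S \<in> polys {1..}"
      using c1 by (intro polys_diff f polys_sum polys_mult polys_of_int schubert_polys) auto
    fix as :: "nat list" assume letters: "set as \<subseteq> {1..}"
    show "coeff (divdiffs as (f - ?S)) 0 = 0"
    proof (cases "reduced as")
      case False
      then show ?thesis using letters by (simp add: divdiffs_not_reduced)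
    next
      case True
      have "coeff (divdiffs as ?S) 0
        = (\<Sum>z\<in>Poly_Mapping.keys c. Poly_Mapping.lookup c z * coeff (divdiffs as (schubert z)) 0)"
        by (simp add: divdiffs_sum lookup_sum divdiffs_of_int coeff_of_int_mult)
      also have "\<dots> = (\<Sum>z\<in>Poly_Mapping.keys c. if z = word_perm as then Poly_Mapping.lookup c z else 0)"
        using c1 by (intro sum.cong refl) (auto simp: divdiffs_schubert_dual[OF True])
      also have "\<dots> = g (word_perm as)"
        by (simp add: sum.delta in_keys_iff lookup_c)
      also have "\<dots> = coeff (divdiffs as f) 0"
        using letters divdiff_perm_eq[OF True] by (simp add: g_def word_perm_S_infty)
      finally show ?thesis by (simp add: divdiffs_diff lookup_minus)
    qed
  qed
  then show ?thesis
  proof (intro that[OF c1])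
    show "f = ?S"
      using \<open>f - ?S = 0\<close> by (simp only: right_minus_eq)
    show "Poly_Mapping.lookup c v = coeff (divdiff_perm v f) 0" if "v \<in> S_infty" for v
      using that by (simp add: lookup_c g_def)
  qed
qed

text \<open>
  Duality also recovers the coordinates from any expansion, which makes the expansion unique.
\<close>
lemma schubert_const_eq:
  assumes u: "u \<in> S_infty" and v: "v \<in> S_infty" and as: "reduced as"
  shows "schubert_const u v (word_perm as) = coeff (divdiffs as (schubert u * schubert v)) 0"
proof -
  let ?f = "schubert u * schubert v"
  have f: "?f \<in> polys {1..}"
    using u v by (intro polys_mult schubert_polys)
  obtain c where c: "Poly_Mapping.keys c \<subseteq> S_infty"
    "\<And>v. v \<in> S_infty \<Longrightarrow> Poly_Mapping.lookup c v = coeff (divdiff_perm v ?f) 0"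
    "?f = (\<Sum>z\<in>Poly_Mapping.keys c. of_int (Poly_Mapping.lookup c z) * schubert z)"
    using schubert_expansion[OF f] by blast
  let ?P = "\<lambda>c :: (nat \<Rightarrow> nat) \<Rightarrow>\<^sub>0 int. Poly_Mapping.keys c \<subseteq> S_infty \<and>
    ?f = (\<Sum>z\<in>Poly_Mapping.keys c. of_int (Poly_Mapping.lookup c z) * schubert z)"
  have uniq: "b = c" if "?P b" for b
  proof (rule poly_mapping_eqI)
    fix z
    show "Poly_Mapping.lookup b z = Poly_Mapping.lookup c z"
    proof (cases "z \<in> S_infty")
      case False
      then have "z \<notin> Poly_Mapping.keys b" "z \<notin> Poly_Mapping.keys c"
        using that c(1) by auto
      then show ?thesis by (simp add: in_keys_iff)
    next
      case True
      obtain bs where bs: "reduced bs" "word_perm bs = z"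
        using reduced_exists[OF True] by blast
      have "coeff (divdiffs bs ?f) 0
        = (\<Sum>z\<in>Poly_Mapping.keys b. Poly_Mapping.lookup b z * coeff (divdiffs bs (schubert z)) 0)"
        using that by (simp add: divdiffs_sum lookup_sum divdiffs_of_int coeff_of_int_mult)
      also have "\<dots> = (\<Sum>y\<in>Poly_Mapping.keys b. if y = z then Poly_Mapping.lookup b y else 0)"
        using that bs by (intro sum.cong refl) (auto simp: divdiffs_schubert_dual[OF bs(1)])
      also have "\<dots> = Poly_Mapping.lookup b z"
        by (simp add: sum.delta in_keys_iff)
      finally show ?thesis
        using c(2)[OF True] divdiff_perm_eq[OF bs] by simp
    qed
  qed
  have "?P c"
    using c(1,3) by (rule conjI)
  then have "(THE c. ?P c) = c"
    using uniq by (rule the_equality)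
  then show ?thesis
    unfolding schubert_const_def
    using c(2)[OF word_perm_S_infty[OF reduced_letters[OF as]]] divdiff_perm_eq[OF as refl] by simp
qed

section \<open>Complete and elementary symmetric polynomials\<close>

text \<open>
  Complete homogeneous symmetric polynomials of a list of ring elements, by splitting the monomials into those
  with and those without the first element.
\<close>
fun complete_sym :: "nat \<Rightarrow> 'a::comm_ring_1 list \<Rightarrow> 'a" where
  "complete_sym 0 xs = 1"
| "complete_sym (Suc c) [] = 0"
| "complete_sym (Suc c) (x # xs) = complete_sym (Suc c) xs + x * complete_sym c (x # xs)"

text \<open>
  The second conjunct is the divided difference of a complete symmetric polynomial; the symmetry in the first two
  entries needs it in the induction.
\<close>
lemma complete_sym_Cons_Cons:
  "complete_sym c (x # y # xs) = complete_sym c (y # x # xs) \<and>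
   (x - y) * complete_sym c (x # y # xs) = complete_sym (Suc c) (x # xs) - complete_sym (Suc c) (y # xs)"
proof (induction c)
  case (Suc c)
  have 1: "complete_sym c (y # x # xs) = complete_sym c (x # y # xs)"
    using Suc by simp
  have 2: "(x - y) * complete_sym c (x # y # xs) = complete_sym (Suc c) (x # xs) - complete_sym (Suc c) (y # xs)"
    using Suc by blast
  have "complete_sym (Suc c) (x # y # xs) - complete_sym (Suc c) (y # x # xs) =
    (x - y) * complete_sym c (x # y # xs) - (complete_sym (Suc c) (x # xs) - complete_sym (Suc c) (y # xs))"
    unfolding complete_sym.simps(3)[of c x "y # xs"] complete_sym.simps(3)[of c y "x # xs"] 1
    by (simp add: left_diff_distrib)
  moreover have "(x - y) * complete_sym (Suc c) (x # y # xs) =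
    (x - y) * complete_sym (Suc c) (y # xs) + x * ((x - y) * complete_sym c (x # y # xs))"
    unfolding complete_sym.simps(3)[of c x "y # xs"] by (simp add: algebra_simps)
  ultimately show ?case
    unfolding 2 complete_sym.simps(3)[of "Suc c"] by (simp add: algebra_simps)
qed simp

lemma complete_sym_swap: "complete_sym c (as @ x # y # bs) = complete_sym c (as @ y # x # bs)"
proof (induction as arbitrary: c)
  case (Cons a as)
  then show ?case by (induction c) auto
qed (use complete_sym_Cons_Cons in auto)

lemma complete_sym_snoc:
  "complete_sym (Suc c) (xs @ [x]) = complete_sym (Suc c) xs + x * complete_sym c (xs @ [x])"
proof (induction xs arbitrary: c)
  case (Cons y ys)
  show ?case
  proof (induction c)
    case 0
    then show ?case using Cons[of 0] by simp
  next
    case (Suc c)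
    let ?A = "complete_sym (Suc c) (ys @ [x])" and ?T = "complete_sym c (y # ys @ [x])"
    have e: "complete_sym (Suc c) (y # ys @ [x]) = complete_sym (Suc c) (y # ys) + x * ?T"
      using Suc by (simp only: append_Cons)
    have "complete_sym (Suc (Suc c)) (y # ys @ [x]) =
      complete_sym (Suc (Suc c)) (ys @ [x]) + y * complete_sym (Suc c) (y # ys @ [x])"
      by (rule complete_sym.simps)
    also have "\<dots> = (complete_sym (Suc (Suc c)) ys + x * ?A) + y * (complete_sym (Suc c) (y # ys) + x * ?T)"
      by (simp only: Cons e)
    also have "\<dots> = (complete_sym (Suc (Suc c)) ys + y * complete_sym (Suc c) (y # ys)) + x * (?A + y * ?T)"
      by (simp only: ring_distribs ac_simps)
    also have "\<dots> = complete_sym (Suc (Suc c)) (y # ys) + x * complete_sym (Suc c) (y # ys @ [x])"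
      by (simp only: complete_sym.simps)
    finally show ?case by (simp only: append_Cons)
  qed
qed simp

lemma swap_vars_complete_sym: "swap_vars i (complete_sym c xs) = complete_sym c (map (swap_vars i) xs)"
  by (induction c xs rule: complete_sym.induct) (auto simp: swap_vars_add swap_vars_mult)

text \<open>
  The complete symmetric polynomial of degree \<open>c\<close> in \<open>x\<^sub>k, \<dots>, x\<^sub>V\<close>.  The list starts with \<open>x\<^sub>V\<close> because \<open>\<partial>\<^sub>V\<close>
  puts \<open>x\<^sub>V\<^sub>+\<^sub>1\<close> in front of it.
\<close>
definition complete_vars :: "nat \<Rightarrow> nat \<Rightarrow> nat \<Rightarrow> ipoly" where
  "complete_vars k V c = complete_sym c (map Var (rev [k..<Suc V]))"

lemma complete_vars_0 [simp]: "complete_vars k V 0 = 1"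
  by (simp add: complete_vars_def)

lemma complete_vars_Suc: "k \<le> V \<Longrightarrow> complete_vars k V (Suc c) = complete_vars (Suc k) V (Suc c) + Var k * complete_vars k V c"
  using complete_sym_snoc[of c "map Var (rev [Suc k..<Suc V])" "Var k"]
  by (simp add: complete_vars_def upt_conv_Cons del: upt_Suc)

lemma swap_vars_complete_vars:
  assumes "k \<le> i" "i < V"
  shows "swap_vars i (complete_vars k V c) = complete_vars k V c"
proof -
  have "[k..<Suc V] = [k..<i] @ i # Suc i # [Suc (Suc i)..<Suc V]"
    using assms upt_add_eq_append[of k i "Suc V - i"] by (simp add: upt_conv_Cons del: upt_Suc)
  then have eq: "map Var (rev [k..<Suc V]) =
    map Var (rev [Suc (Suc i)..<Suc V]) @ Var (Suc i) # Var i # map Var (rev [k..<i])"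
    by (simp del: upt_Suc)
  have 1: "map (swap_vars i) (map Var (rev [Suc (Suc i)..<Suc V])) = map Var (rev [Suc (Suc i)..<Suc V])"
    and 2: "map (swap_vars i) (map Var (rev [k..<i])) = map Var (rev [k..<i])"
    by (auto simp: swap_vars_Var transpose_def)
  show ?thesis
    unfolding complete_vars_def swap_vars_complete_sym eq map_append list.map(2) 1 2
    by (simp add: swap_vars_Var complete_sym_swap del: upt_Suc)
qed

lemma divdiff_complete_vars:
  assumes "k \<le> V"
  shows "divdiff V (complete_vars k V c) = (case c of 0 \<Rightarrow> 0 | Suc c' \<Rightarrow> complete_vars k (Suc V) c')"
proof (cases c)
  case 0
  then show ?thesis by (simp add: divdiff_eq_0_iff)
next
  case (Suc c')
  let ?ys = "map Var (rev [k..<V])"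
  have V: "complete_vars k V (Suc c') = complete_sym (Suc c') (Var V # ?ys)"
    using assms by (simp add: complete_vars_def)
  have SV: "complete_vars k (Suc V) c' = complete_sym c' (Var V # Var (Suc V) # ?ys)"
    using assms complete_sym_Cons_Cons[of c' "Var V" "Var (Suc V)" ?ys] by (simp add: complete_vars_def)
  have ys: "map (swap_vars V) ?ys = ?ys"
    by (auto simp: swap_vars_Var transpose_def)
  have sV: "swap_vars V (complete_vars k V (Suc c')) = complete_sym (Suc c') (Var (Suc V) # ?ys)"
    unfolding V swap_vars_complete_sym list.map(2) ys by (simp add: swap_vars_Var)
  have "divdiff V (complete_vars k V (Suc c')) = complete_vars k (Suc V) c'"
    unfolding SV
  proof (rule divdiff_unique, unfold sV, unfold V)
    show "complete_sym c' (Var V # Var (Suc V) # ?ys) * (Var V - Var (Suc V)) =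
      complete_sym (Suc c') (Var V # ?ys) - complete_sym (Suc c') (Var (Suc V) # ?ys)"
      using complete_sym_Cons_Cons[of c' "Var V" "Var (Suc V)" ?ys] by (metis mult.commute)
  qed
  then show ?thesis using Suc by simp
qed

lemma divdiff_1 [simp]: "divdiff i 1 = 0"
  by (simp add: divdiff_eq_0_iff)

lemma divdiffs_block_power:
  "k \<le> V \<Longrightarrow> divdiffs (rev [k..<V]) (Var k ^ a) = (if V - k \<le> a then complete_vars k V (a - (V - k)) else 0)"
proof (induction V rule: dec_induct)
  case base
  have "complete_sym a [Var k] = Var k ^ a"
    by (induction a) auto
  then show ?case by (simp add: complete_vars_def)
next
  case (step V)
  then have "divdiffs (rev [k..<Suc V]) (Var k ^ a) = divdiff V (if V - k \<le> a then complete_vars k V (a - (V - k)) else 0)"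
    by simp
  also have "\<dots> = (if Suc V - k \<le> a then complete_vars k (Suc V) (a - (Suc V - k)) else 0)"
  proof (cases "a - (V - k)")
    case 0
    then show ?thesis using step by (auto simp: divdiff_complete_vars Suc_diff_le)
  next
    case (Suc c)
    then have "V - k \<le> a" "Suc V - k \<le> a" "a - (Suc V - k) = c"
      using step by linarith+
    then show ?thesis using Suc step by (simp add: divdiff_complete_vars)
  qed
  finally show ?case .
qed

text \<open>\<open>signed_elem k c\<close> is \<open>(-1)\<^sup>c\<close> times the elementary symmetric polynomial of degree \<open>c\<close> in \<open>x\<^sub>1, \<dots>, x\<^sub>k\<close>.\<close>
fun signed_elem :: "nat \<Rightarrow> nat \<Rightarrow> ipoly" where
  "signed_elem 0 c = (if c = 0 then 1 else 0)"
| "signed_elem (Suc k) 0 = 1"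
| "signed_elem (Suc k) (Suc c) = signed_elem k (Suc c) - Var (Suc k) * signed_elem k c"

lemma signed_elem_0 [simp]: "signed_elem k 0 = 1"
  by (cases k) auto

lemma signed_elem_eq_0: "k < c \<Longrightarrow> signed_elem k c = 0"
  by (induction k c rule: signed_elem.induct) auto

lemma signed_elem_polys: "signed_elem k c \<in> polys {1..k}"
proof (induction k c rule: signed_elem.induct)
  case (3 k c)
  have "polys {1..k} \<subseteq> polys {1..Suc k}"
    by (rule polys_mono) auto
  then show ?case
    unfolding signed_elem.simps using 3 by (intro polys_diff polys_mult polys_Var) auto
qed auto

lemma prod_eq_signed_elem:
  "(\<Prod>i\<in>{1..k}. y - Var i) = (\<Sum>c\<le>k. signed_elem k c * y ^ (k - c))"
proof (induction k)
  case (Suc k)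
  let ?E = "\<lambda>c. signed_elem k c * y ^ (k - c)"
  have 1: "(\<Sum>c\<le>k. ?E c) * y = y ^ Suc k + (\<Sum>c\<le>k. signed_elem k (Suc c) * y ^ (k - c))"
  proof -
    have "(\<Sum>c\<le>k. ?E c) * y = (\<Sum>c\<le>k. signed_elem k c * y ^ (Suc k - c))"
      unfolding sum_distrib_right by (rule sum.cong) (auto simp: Suc_diff_le mult_ac)
    also have "\<dots> = (\<Sum>c\<le>Suc k. signed_elem k c * y ^ (Suc k - c))"
      by (simp add: signed_elem_eq_0)
    also have "\<dots> = y ^ Suc k + (\<Sum>c\<le>k. signed_elem k (Suc c) * y ^ (k - c))"
      by (subst sum.atMost_Suc_shift) simp
    finally show ?thesis .
  qed
  have "(\<Sum>c\<le>Suc k. signed_elem (Suc k) c * y ^ (Suc k - c)) =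
    y ^ Suc k + (\<Sum>c\<le>k. signed_elem k (Suc c) * y ^ (k - c)) - (\<Sum>c\<le>k. ?E c) * Var (Suc k)"
    by (subst sum.atMost_Suc_shift)
       (simp add: algebra_simps sum_subtractf sum_distrib_left)
  then show ?case
    using Suc 1 by (simp add: right_diff_distrib)
qed simp

section \<open>Constant terms along Grassmannian words\<close>

text \<open>
  The letters \<open>v\<^sub>k - 1, \<dots>, k\<close> for \<open>k = 1, \<dots>, m\<close> form a reduced word of the Grassmannian permutation with values
  \<open>v\<^sub>1 < \<dots> < v\<^sub>m\<close> at the first \<open>m\<close> positions (\<open>word_perm_block_word\<close>, \<open>reduced_block_word\<close>).
\<close>
primrec block_word :: "(nat \<Rightarrow> nat) \<Rightarrow> nat \<Rightarrow> nat list" where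
  "block_word v 0 = []"
| "block_word v (Suc m) = block_word v m @ rev [Suc m..<v (Suc m)]"

primrec vandermonde :: "nat \<Rightarrow> ipoly" where
  "vandermonde 0 = 1"
| "vandermonde (Suc m) = vandermonde m * (\<Prod>i\<in>{1..m}. Var (Suc m) - Var i)"

definition value_exponents :: "(nat \<Rightarrow> nat) \<Rightarrow> nat \<Rightarrow> (nat \<Rightarrow>\<^sub>0 nat)" where
  "value_exponents v m = (\<Sum>i=1..m. Poly_Mapping.single i (v i - 1))"

definition ascending :: "(nat \<Rightarrow> nat) \<Rightarrow> nat \<Rightarrow> bool" where
  "ascending v m \<longleftrightarrow> (\<forall>i\<in>{1..m}. 1 \<le> v i) \<and> (\<forall>i\<in>{1..<m}. v i < v (Suc i))"

lemma ascending_SucD: "ascending v (Suc m) \<Longrightarrow> ascending v m"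
  by (auto simp: ascending_def)

lemma ascending_ge: "ascending v m \<Longrightarrow> m \<le> v m \<or> m = 0"
proof (induction m)
  case (Suc m)
  then have "m \<le> v m \<or> m = 0"
    using ascending_SucD by blast
  then show ?case
    using Suc.prems by (cases "m = 0") (auto simp: ascending_def dest!: bspec[of "{Suc 0..<Suc m}" _ m])
qed simp

lemma set_block_word: "ascending v m \<Longrightarrow> set (block_word v m) \<subseteq> {1..<v m}"
proof (induction m)
  case (Suc m)
  then have IH: "set (block_word v m) \<subseteq> {1..<v m}"
    using ascending_SucD by blast
  have "{1..<v m} \<subseteq> {1..<v (Suc m)}" if "m \<noteq> 0"
  proof -
    have "v m < v (Suc m)"
      using Suc.prems that by (simp add: ascending_def)
    then show ?thesis by auto
  qed
  then have "set (block_word v m) \<subseteq> {1..<v (Suc m)}"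
    using IH by (cases "m = 0") (simp, metis order_trans)
  then show ?case by auto
qed simp

lemma coeff_mult_0: "coeff (f * g) 0 = coeff f 0 * coeff g 0"
proof -
  have "coeff (frag_of k * g) 0 = coeff (frag_of k) 0 * coeff g 0" for k
    using subset_UNIV[of "Poly_Mapping.keys g"]
  proof (induction g rule: frag_induction)
    case (one l)
    have "k + l = 0 \<longleftrightarrow> k = 0 \<and> l = 0"
      using total_degree_add[of k l] by (metis add_is_0 total_degree_eq_0_iff)
    then show ?case by (auto simp: mult_single)
  qed (auto simp: right_diff_distrib lookup_minus)
  note 1 = this
  show ?thesis
    using subset_UNIV[of "Poly_Mapping.keys f"]
    by (induction f rule: frag_induction) (auto simp: 1 left_diff_distrib lookup_minus)
qed

lemma coeff_complete_sym_0: "\<forall>x\<in>set xs. coeff x 0 = 0 \<Longrightarrow> coeff (complete_sym c xs) 0 = (if c = 0 then 1 else 0)"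
  by (induction c xs rule: complete_sym.induct) (auto simp: lookup_add coeff_mult_0)

lemma coeff_Var_0 [simp]: "coeff (Var i) 0 = 0"
proof -
  have "Poly_Mapping.single i (1::nat) \<noteq> 0"
    using total_degree_eq_0_iff[of "Poly_Mapping.single i 1"] by simp
  then show ?thesis by (auto simp: Var_def)
qed

text \<open>
  Inside the constant term, complete symmetric polynomials in the last variables can be traded for elementary ones in
  the first variables.  For \<open>j = 0\<close> the polynomial in \<open>x\<^sub>1, \<dots>, x\<^sub>V\<close> is invariant under all letters of the
  word, so it moves out of the divided differences and only its constant term matters.  The step to \<open>j + 1\<close> removes
  \<open>x\<^sub>j\<^sub>+\<^sub>1\<close> from the complete symmetric polynomial and adds it to the elementary one by the same recursion.
\<close>
lemma complete_vars_to_signed_elem: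
  assumes v: "ascending v m" and V: "m = 0 \<or> v m < V" "1 \<le> V" and "j \<le> m"
  shows "coeff (divdiffs (block_word v m) (q * complete_vars (Suc j) V c)) 0 =
         coeff (divdiffs (block_word v m) (q * signed_elem j c)) 0"
  using \<open>j \<le> m\<close>
proof (induction j arbitrary: c q)
  case 0
  have "swap_vars i (complete_vars 1 V c) = complete_vars 1 V c" if "i \<in> set (block_word v m)" for i
    using set_block_word[OF v] that V by (intro swap_vars_complete_vars) (cases "m = 0"; auto)+
  then have "divdiffs (block_word v m) (q * complete_vars 1 V c) = divdiffs (block_word v m) q * complete_vars 1 V c"
    by (rule divdiffs_mult_invariant)
  moreover have "coeff (complete_vars 1 V c) 0 = (if c = 0 then 1 else 0)"
    unfolding complete_vars_def by (rule coeff_complete_sym_0) auto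
  ultimately show ?case by (simp add: coeff_mult_0)
next
  case (Suc j)
  show ?case
  proof (cases c)
    case 0
    then show ?thesis by simp
  next
    case (Suc c')
    have "Suc j \<le> V"
      using ascending_ge[OF v] V Suc.prems by auto
    then have eq: "complete_vars (Suc (Suc j)) V (Suc c') = complete_vars (Suc j) V (Suc c') - Var (Suc j) * complete_vars (Suc j) V c'"
      by (simp add: complete_vars_Suc)
    have "q * complete_vars (Suc (Suc j)) V c = q * complete_vars (Suc j) V (Suc c') - (q * Var (Suc j)) * complete_vars (Suc j) V c'"
      by (simp only: Suc eq right_diff_distrib mult.assoc)
    moreover have "q * signed_elem (Suc j) c = q * signed_elem j (Suc c') - (q * Var (Suc j)) * signed_elem j c'"
      by (simp only: Suc signed_elem.simps right_diff_distrib mult.assoc)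
    moreover have "j \<le> m" using Suc.prems by simp
    ultimately show ?thesis
      using Suc.IH by (simp only: divdiffs_diff lookup_minus)
  qed
qed

lemma coeff_mult_new_Var_power:
  assumes Q: "Q \<in> polys {1..m}" and K: "Poly_Mapping.keys K \<subseteq> {1..m}"
  shows "coeff (Q * Var (Suc m) ^ p) (K + Poly_Mapping.single (Suc m) q) = (if p = q then coeff Q K else 0)"
proof -
  have "Poly_Mapping.keys Q \<subseteq> {k. Poly_Mapping.keys k \<subseteq> {1..m}}"
    using Q by (auto simp: polys_def)
  then show ?thesis
  proof (induction Q rule: frag_induction)
    case (one k)
    have z: "expo k (Suc m) = 0" "expo K (Suc m) = 0"
      using one K by (auto simp: in_keys_iff subset_iff)
    have "k + Poly_Mapping.single (Suc m) p = K + Poly_Mapping.single (Suc m) q \<longleftrightarrow> p = q \<and> k = K"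
      using z by (metis add_right_cancel lookup_add lookup_single_eq add_0)
    then show ?case by (auto simp: Var_power mult_single)
  qed (auto simp: left_diff_distrib lookup_minus)
qed

lemma vandermonde_polys: "vandermonde m \<in> polys {1..m}"
proof (induction m)
  case (Suc m)
  have "polys {1..m} \<subseteq> polys {1..Suc m}"
    by (rule polys_mono) auto
  then show ?case
    using Suc unfolding vandermonde.simps by (intro polys_mult polys_prod polys_diff polys_Var) auto
qed simp

lemma keys_value_exponents: "Poly_Mapping.keys (value_exponents v m) \<subseteq> {1..m}"
  unfolding value_exponents_def by (rule order_trans[OF keys_sum]) auto

text \<open>
  Induction on \<open>m\<close>, for a monomial \<open>x\<^sub>m\<^sub>+\<^sub>1\<^sup>a g\<close> with \<open>g\<close> in \<open>x\<^sub>1, \<dots>, x\<^sub>m\<close>.  The last block of letters turns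
  \<open>x\<^sub>m\<^sub>+\<^sub>1\<^sup>a\<close> into a complete symmetric polynomial, or into zero, and leaves \<open>g\<close> alone.  Traded for a signed elementary
  polynomial in \<open>x\<^sub>1, \<dots>, x\<^sub>m\<close>, it becomes a coefficient of the factor by which the Vandermonde product grows, so
  both sides satisfy the same recursion.
\<close>
theorem const_term_divdiffs_block_word:
  assumes "ascending v m" "f \<in> polys {1..m}"
  shows "coeff (divdiffs (block_word v m) f) 0 = coeff (vandermonde m * f) (value_exponents v m)"
  using assms
proof (induction m arbitrary: f)
  case 0
  then show ?case by (simp add: value_exponents_def)
next
  case (Suc m)
  let ?V = "v (Suc m)"
  have asc: "ascending v m"
    using Suc.prems ascending_SucD by blast
  have V: "m = 0 \<or> v m < ?V" "1 \<le> ?V" "Suc m \<le> ?V"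
    using Suc.prems ascending_ge[OF Suc.prems(1)] by (auto simp: ascending_def)
  have "Poly_Mapping.keys f \<subseteq> {k. Poly_Mapping.keys k \<subseteq> {1..Suc m}}"
    using Suc.prems by (auto simp: polys_def)
  then show ?case
  proof (induction f rule: frag_induction)
    case (one k)
    define a where "a = expo k (Suc m)"
    define k0 where "k0 = k - Poly_Mapping.single (Suc m) a"
    have k: "k = k0 + Poly_Mapping.single (Suc m) a"
      by (rule poly_mapping_eqI) (auto simp: k0_def a_def lookup_add lookup_minus lookup_single when_def)
    have k0: "Poly_Mapping.keys k0 \<subseteq> {1..m}"
    proof
      fix j assume "j \<in> Poly_Mapping.keys k0"
      then have "j \<noteq> Suc m" "j \<in> Poly_Mapping.keys k"
        by (auto simp: k0_def a_def in_keys_iff lookup_minus lookup_single when_def split: if_splits)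
      then show "j \<in> {1..m}" using one by fastforce
    qed
    define g where "g = frag_of k0"
    have g: "g \<in> polys {1..m}"
      using k0 by (simp add: g_def polys_def)
    have f: "frag_of k = Var (Suc m) ^ a * g"
      by (subst k) (simp add: g_def Var_power mult_single add.commute)
    have inv: "swap_vars i g = g" if "i \<in> set (rev [Suc m..<?V])" for i
      using divdiff_polys_eq_0[OF g, of i] that by (auto simp: divdiff_eq_0_iff)
    define B where "B = (if ?V - Suc m \<le> a then complete_vars (Suc m) ?V (a - (?V - Suc m)) else 0)"
    have L: "divdiffs (block_word v (Suc m)) (frag_of k) = divdiffs (block_word v m) (g * B)"
      using divdiffs_mult_invariant[OF inv, of "rev [Suc m..<?V]" "Var (Suc m) ^ a"] divdiffs_block_power[OF V(3), of a]
      by (simp add: f B_def mult.commute)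
    have P: "vandermonde m * g * signed_elem m c \<in> polys {1..m}" for c
      by (intro polys_mult vandermonde_polys g signed_elem_polys)
    have value_exponents: "value_exponents v (Suc m) = value_exponents v m + Poly_Mapping.single (Suc m) (?V - 1)"
      by (simp add: value_exponents_def)
    have "vandermonde (Suc m) * frag_of k =
      (\<Sum>c\<le>m. vandermonde m * g * signed_elem m c * Var (Suc m) ^ (m - c + a))"
      unfolding vandermonde.simps f prod_eq_signed_elem
      by (simp only: sum_distrib_left sum_distrib_right power_add mult_ac)
    then have R: "coeff (vandermonde (Suc m) * frag_of k) (value_exponents v (Suc m)) =
      (\<Sum>c\<le>m. if m - c + a = ?V - 1 then coeff (vandermonde m * g * signed_elem m c) (value_exponents v m) else 0)"
      by (simp only: lookup_sum value_exponents coeff_mult_new_Var_power[OF P keys_value_exponents])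
    show ?case
    proof (cases "?V - Suc m \<le> a")
      case False
      then have "coeff (vandermonde (Suc m) * frag_of k) (value_exponents v (Suc m)) = 0"
        unfolding R by (intro sum.neutral) auto
      then show ?thesis
        using False unfolding L B_def by (simp del: vandermonde.simps)
    next
      case True
      \<comment> \<open>The only summand that reaches exponent \<open>?V - 1\<close>; it is absent, and \<open>signed_elem m ?c\<close> zero, if \<open>?c > m\<close>.\<close>
      let ?c = "a - (?V - Suc m)"
      have "coeff (divdiffs (block_word v (Suc m)) (frag_of k)) 0 = coeff (divdiffs (block_word v m) (g * signed_elem m ?c)) 0"
        unfolding L using True complete_vars_to_signed_elem[OF asc V(1,2) order_refl] by (simp add: B_def)
      also have "\<dots> = coeff (vandermonde m * (g * signed_elem m ?c)) (value_exponents v m)"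
        by (intro Suc.IH asc polys_mult g signed_elem_polys)
      also have "\<dots> = (\<Sum>c\<le>m. if c = ?c then coeff (vandermonde m * g * signed_elem m c) (value_exponents v m) else 0)"
        by (simp add: mult.assoc signed_elem_eq_0)
      also have "\<dots> = coeff (vandermonde (Suc m) * frag_of k) (value_exponents v (Suc m))"
        unfolding R using True V by (intro sum.cong refl) auto
      finally show ?thesis .
    qed
  qed (auto simp: divdiffs_diff right_diff_distrib lookup_minus)
qed

section \<open>Grassmannian permutations\<close>

lemma coeff_mult_frag_of: "coeff (frag_of k * f) (k + l) = coeff f l"
  using subset_UNIV[of "Poly_Mapping.keys f"]
  by (induction f rule: frag_induction) (auto simp: mult_single right_diff_distrib lookup_minus)

lemma coeff_mult_frag_of_eq_0:
  assumes "\<And>l. K \<noteq> k + l"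
  shows "coeff (frag_of k * f) K = 0"
  using subset_UNIV[of "Poly_Mapping.keys f"]
proof (induction f rule: frag_induction)
  case (one l)
  then show ?case using assms[of l] by (simp add: mult_single)
qed (auto simp: right_diff_distrib lookup_minus)

lemma ascending_ge_index:
  assumes "ascending v m" "1 \<le> i" "i \<le> m"
  shows "i \<le> v i"
  using assms(2,3)
proof (induction i rule: dec_induct)
  case base
  then show ?case using assms(1) by (auto simp: ascending_def)
next
  case (step i)
  then have "v i < v (Suc i)"
    using assms(1) by (auto simp: ascending_def)
  then show ?case using step by auto
qed

lemma expo_sum_single:
  "finite A \<Longrightarrow> expo (\<Sum>i\<in>A. Poly_Mapping.single i (e i)) j = (if j \<in> A then e j else 0)"
  by (simp add: lookup_sum lookup_single when_def sum.delta)

lemma expo_value_exponents: "expo (value_exponents v m) j = (if j \<in> {1..m} then v j - 1 else 0)"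
  unfolding value_exponents_def by (subst expo_sum_single) auto

lemma ascending_id: "ascending (\<lambda>i. i) m"
  by (auto simp: ascending_def)

lemma block_word_id: "block_word (\<lambda>i. i) m = []"
  by (induction m) auto

text \<open>The empty word is the case \<open>v\<^sub>i = i\<close> of the constant term formula; it is applied here to \<open>f = 1\<close>.\<close>
lemma coeff_vandermonde_diagonal: "coeff (vandermonde m) (value_exponents (\<lambda>i. i) m) = 1"
  using const_term_divdiffs_block_word[OF ascending_id polys_1, of m] by (simp add: block_word_id)

text \<open>
  A word that is not reduced acts as zero, but the constant term at the monomial with exponents \<open>v\<^sub>i - i\<close> is the
  diagonal coefficient of the Vandermonde product, which is 1 (\<open>coeff_vandermonde_diagonal\<close>).
\<close>
lemma reduced_block_word:
  assumes v: "ascending v m"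
  shows "reduced (block_word v m)"
proof (rule ccontr)
  assume "\<not> reduced (block_word v m)"
  moreover have "set (block_word v m) \<subseteq> {1..}"
    using set_block_word[OF v] by (rule order_trans) auto
  ultimately have zero: "divdiffs (block_word v m) f = 0" for f
    by (simp add: divdiffs_not_reduced)
  let ?K = "\<Sum>i=1..m. Poly_Mapping.single i (v i - i)"
  have "value_exponents v m = ?K + value_exponents (\<lambda>i. i) m"
    by (rule poly_mapping_eqI)
       (use ascending_ge_index[OF v] in \<open>auto simp: expo_value_exponents expo_sum_single lookup_add\<close>)
  then have "coeff (vandermonde m * frag_of ?K) (value_exponents v m) = 1"
    using coeff_mult_frag_of[of ?K "vandermonde m" "value_exponents (\<lambda>i. i) m"] coeff_vandermonde_diagonal
    by (simp add: mult.commute)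
  moreover have "frag_of ?K \<in> polys {1..m}"
    by (auto simp: polys_def in_keys_iff expo_sum_single split: if_splits)
  ultimately show False
    using const_term_divdiffs_block_word[OF v] zero by simp
qed

lemma word_perm_fixes: "set as \<subseteq> {1..<n} \<Longrightarrow> n < j \<Longrightarrow> word_perm as j = j"
  by (induction as) (auto simp: transpose_def)

lemma word_perm_block_word:
  assumes "ascending v m"
  shows "(\<forall>i\<in>{1..m}. word_perm (block_word v m) i = v i) \<and>
         (\<forall>j>m. word_perm (block_word v m) j < word_perm (block_word v m) (Suc j))"
  using assms
proof (induction m)
  case (Suc m)
  let ?W = "word_perm (block_word v m)" and ?V = "v (Suc m)"
  have asc: "ascending v m"
    using Suc.prems ascending_SucD by blast
  have V: "Suc m \<le> ?V" "m \<noteq> 0 \<Longrightarrow> v m < ?V"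
    using ascending_ge[OF Suc.prems] Suc.prems by (auto simp: ascending_def)
  have IH1: "?W i = v i" if "1 \<le> i" "i \<le> m" for i
    using Suc.IH[OF asc] that by simp
  have IH2: "?W j < ?W (Suc j)" if "m < j" for j
    using Suc.IH[OF asc] that by simp
  have WV: "?W ?V = ?V"
    using word_perm_fixes[OF set_block_word[OF asc], of ?V] V by (cases "m = 0") auto
  have W: "word_perm (block_word v (Suc m)) j =
    ?W (if j = Suc m then ?V else if Suc m < j \<and> j \<le> ?V then j - 1 else j)" for j
    by (simp only: block_word.simps word_perm_append comp_apply word_perm_block[OF V(1)])
  show ?case
  proof (intro conjI ballI allI impI)
    fix i assume "i \<in> {1..Suc m}"
    then show "word_perm (block_word v (Suc m)) i = v i"
      unfolding W using IH1[of i] WV by (cases "i = Suc m") auto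
  next
    fix j assume j: "Suc m < j"
    consider "Suc j \<le> ?V" | "j = ?V" | "?V < j" by linarith
    then show "word_perm (block_word v (Suc m)) j < word_perm (block_word v (Suc m)) (Suc j)"
    proof cases
      case 1
      then show ?thesis unfolding W using j IH2[of "j - 1"] by auto
    next
      case 2
      have "m < j - 1" "Suc (j - 1) = j" using j by auto
      then have "?W (j - 1) < ?W (Suc j)"
        using IH2[of "j - 1"] IH2[of j] j by simp
      then show ?thesis unfolding W using 2 j by simp
    next
      case 3
      then show ?thesis unfolding W using j IH2[of j] by auto
    qed
  qed
qed simp

text \<open>
  At the first position where the two permutations differ, the smaller one takes a value that the other one can
  only take further to the right, where its values are larger.
\<close>
lemma grassmannian_unique:
  assumes u: "u \<in> S_infty" "\<And>j. m < j \<Longrightarrow> u j < u (Suc j)"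
    and w: "w \<in> S_infty" "\<And>j. m < j \<Longrightarrow> w j < w (Suc j)"
    and eq: "\<And>i. 1 \<le> i \<Longrightarrow> i \<le> m \<Longrightarrow> u i = w i"
  shows "u = w"
proof
  have less_imp: False
    if S: "u \<in> S_infty" "w \<in> S_infty" and inc: "\<And>j. m < j \<Longrightarrow> w j < w (Suc j)" and mi: "m < i"
      and agree: "\<And>j. j < i \<Longrightarrow> u j = w j" and lt: "u i < w i" for u w :: "nat \<Rightarrow> nat" and i
  proof -
    obtain p where p: "w p = u i"
      using S_infty_bij[OF S(2)] by (metis bij_pointE)
    have "i \<le> p"
    proof (rule ccontr)
      assume "\<not> i \<le> p"
      then have "u p = u i" using agree[of p] p by simp
      then show False
        using S_infty_bij[OF S(1)] \<open>\<not> i \<le> p\<close> by (metis bij_is_inj injD order_refl)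
    qed
    then have "w i \<le> w p"
    proof (induction rule: dec_induct)
      case (step n)
      then show ?case using inc[of n] mi by simp
    qed simp
    then show False using p lt by simp
  qed
  fix i
  show "u i = w i"
  proof (induction i rule: less_induct)
    case (less i)
    consider "i = 0" | "1 \<le> i" "i \<le> m" | "m < i" by linarith
    then show ?case
    proof cases
      case 1
      then show ?thesis using S_infty_0[OF u(1)] S_infty_0[OF w(1)] by simp
    next
      case 2
      then show ?thesis by (rule eq)
    next
      case 3
      have "\<not> u i < w i"
        using less_imp[OF u(1) w(1) w(2) 3] less by blast
      moreover have "\<not> w i < u i"
        using less_imp[OF w(1) u(1) u(2) 3] less by metis
      ultimately show ?thesis by simp
    qed
  qed
qed

lemma word_perm_block_word_S_infty: "ascending v m \<Longrightarrow> word_perm (block_word v m) \<in> S_infty"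
  using reduced_block_word reduced_letters word_perm_S_infty by blast

lemma grassmannian_eq:
  assumes v: "ascending v m"
    and lam: "lam = map (\<lambda>i. int (v i) - int i) (rev [1..<Suc m])"
  shows "grassmannian lam m = word_perm (block_word v m)"
  unfolding grassmannian_def
proof (rule the_equality)
  let ?W = "word_perm (block_word v m)"
  have W1: "?W i = v i" if "1 \<le> i" "i \<le> m" for i
    using word_perm_block_word[OF v] that by simp
  have W2: "?W j < ?W (Suc j)" if "m < j" for j
    using word_perm_block_word[OF v] that by simp
  have "?W i < ?W (Suc i)" if "1 \<le> i" "i \<noteq> m" for i
  proof (cases "m < i")
    case False
    then show ?thesis using that W1[of i] W1[of "Suc i"] v by (simp add: ascending_def)
  qed (rule W2)
  moreover have "map (\<lambda>i. int (?W i) - int i) (rev [1..<Suc m]) = lam"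
    unfolding lam by (rule map_cong) (auto simp: W1)
  ultimately show "?W \<in> S_infty \<and> (\<forall>i\<ge>1. i \<noteq> m \<longrightarrow> ?W i < ?W (Suc i)) \<and>
      map (\<lambda>i. int (?W i) - int i) (rev [1..<Suc m]) = lam"
    using word_perm_block_word_S_infty[OF v] by blast
  fix u assume u: "u \<in> S_infty \<and> (\<forall>i\<ge>1. i \<noteq> m \<longrightarrow> u i < u (Suc i)) \<and>
      map (\<lambda>i. int (u i) - int i) (rev [1..<Suc m]) = lam"
  then have "\<forall>i\<in>set (rev [1..<Suc m]). int (u i) - int i = int (v i) - int i"
    unfolding lam by (metis (no_types, lifting) map_eq_conv)
  then have "u i = v i" if "1 \<le> i" "i \<le> m" for i
    using that by auto
  then show "u = ?W"
    by (intro grassmannian_unique[where m = m]) (use u W1 W2 word_perm_block_word_S_infty[OF v] in auto)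
qed

section \<open>The alternant of a Grassmannian Schubert polynomial\<close>

lemma swap_vars_vandermonde:
  "1 \<le> i \<Longrightarrow> i < m \<Longrightarrow> swap_vars i (vandermonde m) = - vandermonde m"
proof (induction m)
  case (Suc m)
  show ?case
  proof (cases "i < m")
    case True
    have "swap_vars i (\<Prod>j\<in>{1..m}. Var (Suc m) - Var j) = (\<Prod>j\<in>{1..m}. Var (Suc m) - Var j)"
      unfolding swap_vars_prod swap_vars_diff swap_vars_Var
      by (rule prod.reindex_bij_witness[of _ "adj i" "adj i"]) (use True Suc.prems in \<open>auto simp: transpose_def\<close>)
    then show ?thesis
      using Suc True by (simp add: swap_vars_mult)
  next
    case False
    then obtain n where n: "i = Suc n" "m = Suc n"
      using Suc.prems by (metis Suc_le_D Suc_le_lessD less_antisym One_nat_def)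
    let ?P = "\<lambda>j. \<Prod>i\<in>{1..n}. Var j - Var i"
    have D: "vandermonde (Suc m) = vandermonde n * ?P (Suc n) * (?P (Suc (Suc n)) * (Var (Suc (Suc n)) - Var (Suc n)))"
      by (simp add: n mult.assoc)
    have P: "swap_vars i (?P j) = ?P (adj i j)" for j
      unfolding swap_vars_prod swap_vars_diff swap_vars_Var
      by (rule prod.cong) (auto simp: n transpose_def)
    have "swap_vars i (vandermonde n) = vandermonde n"
      using divdiff_polys_eq_0[OF vandermonde_polys, of n i] by (simp add: n divdiff_eq_0_iff)
    then have "swap_vars i (vandermonde (Suc m)) =
      vandermonde n * ?P (Suc (Suc n)) * (?P (Suc n) * (Var (Suc n) - Var (Suc (Suc n))))"
      unfolding D swap_vars_mult swap_vars_diff P by (simp add: n swap_vars_Var)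
    also have "\<dots> = - vandermonde (Suc m)"
    proof -
      have "Var (Suc n) - Var (Suc (Suc n)) = - (Var (Suc (Suc n)) - Var (Suc n))"
        by simp
      then show ?thesis
        unfolding D by (simp only: mult_minus_right mult_minus_left mult_ac)
    qed
    finally show ?thesis .
  qed
qed simp

lemma schubert_polys_bounded:
  assumes u: "u \<in> S_infty" "\<And>j. m < j \<Longrightarrow> u j < u (Suc j)"
  shows "schubert u \<in> polys {1..m}"
proof (rule invariant_beyond[OF schubert_polys[OF u(1)]])
  fix i assume "m < i"
  then have "divdiff i (schubert u) = 0"
    using divdiff_schubert[OF u(1), of i] u(2)[of i] by simp
  then show "swap_vars i (schubert u) = schubert u"
    by (simp add: divdiff_eq_0_iff)
qed

definition alternant :: "(nat \<Rightarrow> nat) \<Rightarrow> nat \<Rightarrow> ipoly" where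
  "alternant v m = vandermonde m * schubert (word_perm (block_word v m))"

lemma schubert_block_word_polys: "ascending v m \<Longrightarrow> schubert (word_perm (block_word v m)) \<in> polys {1..m}"
  using word_perm_block_word[of v m] word_perm_block_word_S_infty by (intro schubert_polys_bounded) auto

lemma swap_vars_alternant:
  assumes v: "ascending v m" and i: "1 \<le> i" "i < m"
  shows "swap_vars i (alternant v m) = - alternant v m"
proof -
  have "word_perm (block_word v m) i = v i" "word_perm (block_word v m) (Suc i) = v (Suc i)"
    using word_perm_block_word[OF v] i by auto
  moreover have "v i < v (Suc i)"
    using v i by (simp add: ascending_def)
  ultimately have "divdiff i (schubert (word_perm (block_word v m))) = 0"
    using divdiff_schubert[OF word_perm_block_word_S_infty[OF v] i(1)] by simp
  then show ?thesis
    using i by (simp add: alternant_def swap_vars_mult swap_vars_vandermonde divdiff_eq_0_iff)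
qed

text \<open>
  The constant term formula, read from right to left, together with duality.
\<close>
lemma coeff_alternant_increasing:
  assumes v: "ascending v m" and u: "ascending u m"
  shows "coeff (alternant v m) (value_exponents u m) = (if \<forall>i\<in>{1..m}. u i = v i then 1 else 0)"
proof -
  have "coeff (alternant v m) (value_exponents u m) = coeff (divdiffs (block_word u m) (schubert (word_perm (block_word v m)))) 0"
    using const_term_divdiffs_block_word[OF u schubert_block_word_polys[OF v]] by (simp add: alternant_def)
  also have "\<dots> = (if word_perm (block_word v m) = word_perm (block_word u m) then 1 else 0)"
    by (rule divdiffs_schubert_dual[OF reduced_block_word[OF u] word_perm_block_word_S_infty[OF v]])
  also have "word_perm (block_word v m) = word_perm (block_word u m) \<longleftrightarrow> (\<forall>i\<in>{1..m}. u i = v i)"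
  proof
    assume "\<forall>i\<in>{1..m}. u i = v i"
    then show "word_perm (block_word v m) = word_perm (block_word u m)"
      using word_perm_block_word[OF v] word_perm_block_word[OF u]
      by (intro grassmannian_unique[where m = m] word_perm_block_word_S_infty v u) auto
  next
    assume "word_perm (block_word v m) = word_perm (block_word u m)"
    then show "\<forall>i\<in>{1..m}. u i = v i"
      using word_perm_block_word[OF v] word_perm_block_word[OF u] by auto
  qed
  finally show ?thesis .
qed

lemma exponent_as_value_exponents:
  assumes K: "Poly_Mapping.keys K \<subseteq> {1..m}" and inc: "\<forall>i\<in>{1..<m}. expo K i < expo K (Suc i)"
  shows "ascending (\<lambda>i. Suc (expo K i)) m \<and> K = value_exponents (\<lambda>i. Suc (expo K i)) m"
proof
  show "ascending (\<lambda>i. Suc (expo K i)) m"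
    using inc by (auto simp: ascending_def)
  show "K = value_exponents (\<lambda>i. Suc (expo K i)) m"
    by (rule poly_mapping_eqI) (use K in \<open>auto simp: expo_value_exponents in_keys_iff\<close>)
qed

text \<open>
  Sort \<open>K\<close> by exchanging adjacent descents.  An exchange only changes the sign of the coefficient, and the bound on \<open>K\<close>
  survives.  Equal neighbours give zero by antisymmetry.  If the last exchange makes the vector increasing, the entry
  moved to position \<open>i + 1\<close> was bounded by the bound for position \<open>i\<close>, hence is smaller than \<open>v\<^sub>i\<^sub>+\<^sub>1 - 1\<close>, and
  an increasing vector other than \<open>(v\<^sub>i - 1)\<close> has coefficient zero.
\<close>
lemma coeff_alternant_eq_0:
  assumes v: "ascending v m"
    and "Poly_Mapping.keys K \<subseteq> {1..m}" "\<forall>i\<in>{1..<m}. Suc (expo K i) < v (Suc i)"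
    and "\<not> (\<forall>i\<in>{1..<m}. expo K i < expo K (Suc i))"
  shows "coeff (alternant v m) K = 0"
  using assms(2-)
proof (induction "\<Sum>j=1..m. (m - j) * expo K j" arbitrary: K rule: less_induct)
  case less
  then obtain i where i: "1 \<le> i" "i < m" "expo K (Suc i) \<le> expo K i"
    by (auto simp: not_less)
  let ?K = "swap_exp i K"
  have "coeff (alternant v m) ?K = coeff (swap_vars i (alternant v m)) K"
    by (simp add: coeff_swap_vars)
  then have anti: "coeff (alternant v m) ?K = - coeff (alternant v m) K"
    by (simp add: swap_vars_alternant[OF v i(1,2)])
  show ?case
  proof (cases "expo K (Suc i) = expo K i")
    case True
    then have "?K = K"
      by (intro poly_mapping_eqI) (auto simp: expo_swap_exp transpose_def)
    then show ?thesis using anti by simp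
  next
    case False
    then have lt: "expo K (Suc i) < expo K i" using i by simp
    have K': "expo ?K i = expo K (Suc i)" "expo ?K (Suc i) = expo K i"
      "\<And>j. j \<noteq> i \<Longrightarrow> j \<noteq> Suc i \<Longrightarrow> expo ?K j = expo K j"
      by (auto simp: expo_swap_exp)
    have keys: "Poly_Mapping.keys ?K \<subseteq> {1..m}"
    proof
      fix j assume "j \<in> Poly_Mapping.keys ?K"
      then have "adj i j \<in> {1..m}"
        by (intro subsetD[OF less.prems(1)]) (simp add: in_keys_iff expo_swap_exp)
      then show "j \<in> {1..m}"
        using i by (auto simp: transpose_def split: if_splits)
    qed
    have bound: "\<forall>j\<in>{1..<m}. Suc (expo ?K j) < v (Suc j)"
    proof
      fix j assume j: "j \<in> {1..<m}"
      consider "j = i" | "j = Suc i" | "j \<noteq> i" "j \<noteq> Suc i" by blast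
      then show "Suc (expo ?K j) < v (Suc j)"
      proof cases
        case 1
        then show ?thesis using less.prems(2) j lt K' by fastforce
      next
        case 2
        then have "Suc (expo K i) < v (Suc i)" "v (Suc i) < v (Suc j)"
          using less.prems(2) i j v by (auto simp: ascending_def)
        then show ?thesis using 2 K' by simp
      next
        case 3
        then show ?thesis using less.prems(2) j K' by simp
      qed
    qed
    \<comment> \<open>Moving the larger entry to the right lowers the weighted sum.\<close>
    have measure: "(\<Sum>j=1..m. (m - j) * expo ?K j) < (\<Sum>j=1..m. (m - j) * expo K j)"
    proof -
      have split: "(\<Sum>j=1..m. (m - j) * e j) =
        (m - i) * e i + ((m - Suc i) * e (Suc i) + (\<Sum>j\<in>{1..m} - {i} - {Suc i}. (m - j) * e j))" for e
        using i by (subst sum.remove[of _ i], simp, simp, subst sum.remove[of _ "Suc i"]) auto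
      have rest: "(\<Sum>j\<in>{1..m} - {i} - {Suc i}. (m - j) * expo ?K j) =
        (\<Sum>j\<in>{1..m} - {i} - {Suc i}. (m - j) * expo K j)"
        by (rule sum.cong) (auto simp: K'(3))
      obtain d where d: "m - i = Suc d" "m - Suc i = d"
        using i by (metis Suc_diff_Suc)
      show ?thesis
        unfolding split rest K' d using lt by simp
    qed
    show ?thesis
    proof (cases "\<forall>j\<in>{1..<m}. expo ?K j < expo ?K (Suc j)")
      case False
      then have "coeff (alternant v m) ?K = 0"
        using less.hyps[OF measure keys bound] by blast
      then show ?thesis using anti by simp
    next
      case True
      let ?u = "\<lambda>j. Suc (expo ?K j)"
      have "ascending ?u m" "?K = value_exponents ?u m"
        using exponent_as_value_exponents[OF keys True] by auto
      moreover have "?u (Suc i) \<noteq> v (Suc i)"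
        using bspec[OF less.prems(2), of i] i K'(2) by simp
      ultimately have "coeff (alternant v m) ?K = 0"
        using coeff_alternant_increasing[OF v, of ?u] i by auto
      then show ?thesis using anti by simp
    qed
  qed
qed

text \<open>
  A monomial of \<open>h\<close> with exponent vector \<open>a\<close> meets the exponent vector \<open>K\<close> of the alternant with
  \<open>a\<^sub>i + K\<^sub>i = v\<^sub>i - 1 + l\<^sub>i\<close>.  Hence \<open>K\<close> obeys the bound of \<open>coeff_alternant_eq_0\<close>, only \<open>K\<^sub>i = v\<^sub>i - 1\<close> contributes, and
  then \<open>a\<^sub>i = l\<^sub>i\<close>.
\<close>
lemma coeff_mult_alternant:
  assumes v: "ascending v m" and h: "h \<in> polys {1..m}"
    and gap: "\<forall>i\<in>{1..<m}. v i + l i < v (Suc i)"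
  shows "coeff (h * alternant v m) (value_exponents (\<lambda>i. v i + l i) m) =
         coeff h (\<Sum>i=1..m. Poly_Mapping.single i (l i))"
proof -
  let ?L = "\<Sum>i=1..m. Poly_Mapping.single i (l i)"
  let ?T = "value_exponents (\<lambda>i. v i + l i) m"
  have pos: "1 \<le> v i" if "i \<in> {1..m}" for i
    using v that by (auto simp: ascending_def)
  have T: "?T = ?L + value_exponents v m"
    by (rule poly_mapping_eqI)
       (use pos in \<open>auto simp: expo_value_exponents expo_sum_single lookup_add\<close>)
  have "coeff (frag_of a * alternant v m) ?T = coeff (frag_of a) ?L" for a
  proof (cases "\<exists>K. ?T = a + K")
    case False
    then have "a \<noteq> ?L" using T by blast
    then show ?thesis using False by (subst coeff_mult_frag_of_eq_0) auto
  next
    case True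
    then obtain K where K: "?T = a + K" by blast
    have eK: "expo K j \<le> expo ?T j" for j
      by (simp add: K lookup_add)
    have keys: "Poly_Mapping.keys K \<subseteq> {1..m}"
    proof
      fix j assume "j \<in> Poly_Mapping.keys K"
      then show "j \<in> {1..m}"
        using eK[of j] by (auto simp: in_keys_iff expo_value_exponents split: if_splits)
    qed
    have bound: "\<forall>i\<in>{1..<m}. Suc (expo K i) < v (Suc i)"
    proof
      fix i assume i: "i \<in> {1..<m}"
      then have "expo K i \<le> v i + l i - 1"
        using eK[of i] by (simp add: expo_value_exponents)
      then show "Suc (expo K i) < v (Suc i)"
        using gap i pos[of i] by fastforce
    qed
    have "a = ?L \<longleftrightarrow> K = value_exponents v m"
      using K T by (metis add_left_cancel add_right_cancel)
    moreover have "coeff (alternant v m) K = (if K = value_exponents v m then 1 else 0)"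
    proof (cases "\<forall>i\<in>{1..<m}. expo K i < expo K (Suc i)")
      case True
      let ?u = "\<lambda>i. Suc (expo K i)"
      have u: "ascending ?u m" "K = value_exponents ?u m"
        using exponent_as_value_exponents[OF keys True] by auto
      have "(\<forall>i\<in>{1..m}. ?u i = v i) \<longleftrightarrow> K = value_exponents v m"
      proof
        assume "K = value_exponents v m"
        then have "expo K i = v i - 1" if "i \<in> {1..m}" for i
          using that by (simp add: expo_value_exponents)
        then show "\<forall>i\<in>{1..m}. ?u i = v i"
          using pos by fastforce
      next
        assume "\<forall>i\<in>{1..m}. ?u i = v i"
        then have "value_exponents ?u m = value_exponents v m"
          unfolding value_exponents_def by (intro sum.cong) auto
        then show "K = value_exponents v m" using u(2) by simp
      qed
      then show ?thesis
        using coeff_alternant_increasing[OF v u(1)] u(2) by simp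
    next
      case False
      then have "coeff (alternant v m) K = 0"
        by (rule coeff_alternant_eq_0[OF v keys bound])
      moreover have "K \<noteq> value_exponents v m"
      proof
        assume "K = value_exponents v m"
        then have "expo K i < expo K (Suc i)" if "i \<in> {1..<m}" for i
          using that v pos[of i] by (auto simp: expo_value_exponents ascending_def intro!: diff_less_mono)
        then show False using False by blast
      qed
      ultimately show ?thesis by simp
    qed
    ultimately show ?thesis
      unfolding K coeff_mult_frag_of by simp metis
  qed
  note monomial = this
  show ?thesis
    using subset_UNIV[of "Poly_Mapping.keys h"]
    by (induction h rule: frag_induction) (simp_all add: monomial left_diff_distrib lookup_minus)
qed

section \<open>Coefficients of Schubert polynomials as structure constants\<close>

text \<open>
  The value at \<open>i \<le> m\<close> of the Grassmannian permutation of shape \<open>\<lambda>\<close>; the sum telescopes the differences \<open>m - j\<close> of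
  consecutive parts of \<open>\<lambda>\<close>.
\<close>
definition lambda_values :: "nat \<Rightarrow> nat \<Rightarrow> nat" where
  "lambda_values m i = i + (\<Sum>j\<in>{1..<i}. m - j)"

lemma lambda_values_Suc: "1 \<le> i \<Longrightarrow> lambda_values m (Suc i) = lambda_values m i + Suc (m - i)"
  by (simp add: lambda_values_def)

lemma lambda_shape_entry:
  assumes "1 \<le> i" "i \<le> m"
  shows "(int i - 1) * int m - int (i choose 2) = int (lambda_values m i) - int i"
  using assms
proof (induction i rule: dec_induct)
  case base
  then show ?case by (simp add: lambda_values_def)
next
  case (step i)
  then have IH: "(int i - 1) * int m - int (i choose 2) = int (lambda_values m i) - int i"
    by simp
  have "Suc i choose 2 = i + (i choose 2)"
    by (simp add: numeral_2_eq_2)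
  then have "(int (Suc i) - 1) * int m - int (Suc i choose 2) =
    ((int i - 1) * int m - int (i choose 2)) + (int m - int i)"
    by (simp add: algebra_simps)
  also have "\<dots> = int (lambda_values m (Suc i)) - int (Suc i)"
    unfolding IH using step by (simp add: lambda_values_Suc of_nat_diff)
  finally show ?case .
qed

theorem corollary9p10:
  fixes w :: "nat \<Rightarrow> nat" and m :: nat and l :: "nat \<Rightarrow> nat"
  assumes "w permutes {1..m}"
    and "\<forall>i\<in>{1..m}. l i \<le> m - i"
  shows "Poly_Mapping.lookup (schubert w) (\<Sum>i=1..m. Poly_Mapping.single i (l i)) =
         schubert_const w (grassmannian (lambda_shape m) m) (grassmannian (lambda_shape' m l) m)"
proof -
  let ?v = "lambda_values m"
  let ?v' = "\<lambda>i. ?v i + l i"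
  have gap: "\<forall>i\<in>{1..<m}. ?v' i < ?v (Suc i)"
  proof
    fix i assume "i \<in> {1..<m}"
    then show "?v' i < ?v (Suc i)"
      using bspec[OF assms(2), of i] lambda_values_Suc[of i m] by auto
  qed
  have pos: "1 \<le> ?v i" if "i \<in> {1..m}" for i
    using that by (auto simp: lambda_values_def)
  have v: "ascending ?v m" and v': "ascending ?v' m"
    using gap pos by (fastforce simp: ascending_def)+
  have lam: "lambda_shape m = map (\<lambda>i. int (?v i) - int i) (rev [1..<Suc m])"
    unfolding lambda_shape_def by (rule map_cong) (auto intro!: lambda_shape_entry)
  have lam': "lambda_shape' m l = map (\<lambda>i. int (?v' i) - int i) (rev [1..<Suc m])"
    unfolding lambda_shape'_def lam map2_map_map by (rule map_cong) auto
  have w: "w \<in> S_infty"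
    using assms(1) by (auto simp: S_infty_iff)
  have w_inc: "w j < w (Suc j)" if "m < j" for j
    using permutes_not_in[OF assms(1), of j] permutes_not_in[OF assms(1), of "Suc j"] that by simp
  have w_polys: "schubert w \<in> polys {1..m}"
    by (rule schubert_polys_bounded[OF w w_inc])
  have "schubert_const w (grassmannian (lambda_shape m) m) (grassmannian (lambda_shape' m l) m) =
    coeff (divdiffs (block_word ?v' m) (schubert w * schubert (word_perm (block_word ?v m)))) 0"
    unfolding grassmannian_eq[OF v lam] grassmannian_eq[OF v' lam']
    by (rule schubert_const_eq[OF w word_perm_block_word_S_infty[OF v] reduced_block_word[OF v']])
  also have "\<dots> = coeff (vandermonde m * (schubert w * schubert (word_perm (block_word ?v m)))) (value_exponents ?v' m)"
    by (intro const_term_divdiffs_block_word v' polys_mult w_polys schubert_block_word_polys v)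
  also have "\<dots> = coeff (schubert w * alternant ?v m) (value_exponents ?v' m)"
    by (simp only: alternant_def mult.left_commute)
  also have "\<dots> = coeff (schubert w) (\<Sum>i=1..m. Poly_Mapping.single i (l i))"
    by (rule coeff_mult_alternant[OF v w_polys gap])
  finally show ?thesis by simp
qed

end
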